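(* Let $(\mathbf{T}(t))_{t\ge0}$ be a Markov semigroup on $\mathcal{C}(\mathcal{Z})$ with stationary probability measure $\mu$, and let $(\mathbf{A},\mathcal{D}(\mathbf{A}))$ denote the generator of its extension to $L^2(\mu)$. Assume that $\mathbf{A}$ is normal on $L^2(\mu)$. Let $g_0\in\mathcal{D}(\mathbf{A}^\infty)$, let $g$ be the solution of $\dot g=\mathbf{A}g$ with $g(0)=g_0$, and set $\mathfrak{e}_m(t)=\mathrm{E}_m(g(t),g(t))$ for $m\in\mathbb{N}$, $t\ge0$. Assume $\mathfrak{e}_0(0)>0$. If $n\ge1$ and $\mathfrak{e}_n(0)>0$, then for all $t\ge 0$ $$\mathfrak{e}_n(t)\le\left(\mathfrak{e}_n(0)^{-1/n}+\frac{t}{n}\,\mathfrak{e}_0(0)^{-1/n}\right)^{-n}.$$ In particular, $t\mapsto\mathfrak{e}_n(t)$ decays to zero with polynomial rate $O(t^{-n})$ as $t\to\infty$.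
   Context: $\mathbb{N}=\{0,1,2,\dots\}$. $\mathcal{Z}$ is a compact metrizable topological space; $\mathcal{C}(\mathcal{Z})$ is the space of real-valued continuous functions on $\mathcal{Z}$ with the supremum norm and pointwise order; $\mathbf{1}$ is the constant function one. A Markov operator is a bounded linear operator $\mathbf{M}$ on $\mathcal{C}(\mathcal{Z})$ with $\mathbf{M}\mathbf{1}=\mathbf{1}$ and $\mathbf{M}g\ge0$ whenever $g\ge0$. A Markov semigroup $(\mathbf{T}(t))_{t\ge0}$ is a strongly continuous semigroup of Markov operators on $\mathcal{C}(\mathcal{Z})$. A stationary probability measure is a Borel probability measure $\mu$ on $\mathcal{Z}$ with $\int\mathbf{T}(t)g\,\mathrm{d}\mu=\int g\,\mathrm{d}\mu$ for all $g\in\mathcal{C}(\mathcal{Z})$ and $t\ge0$. $L^2(\mu)$ is the real Hilbert space with scalar product $(f,g)_\mu=\int_{\mathcal{Z}}f g\,\mathrm{d}\mu$ and norm $\|\cdot\|_\mu$. The semigroup $\mathbf{T}(t)$ extends to a strongly continuous contraction semigroup on $L^2(\mu)$, also denoted $\mathbf{T}(t)$; its generator on $L^2(\mu)$ is denoted $(\mathbf{A},\mathcal{D}(\mathbf{A}))$ with $\mathcal{D}(\mathbf{A})\subset L^2(\mu)$, and $\mathcal{D}(\mathbf{A}^\infty)=\bigcap_n\mathcal{D}(\mathbf{A}^n)$. The solution of $\dot g=\mathbf{A}g$, $g(0)=g_0$ is $g(t)=\mathbf{T}(t)g_0$. Let $\mathbf{A}^\star$ be the $L^2(\mu)$-adjoint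 of $\mathbf{A}$. $\mathbf{A}$ is normal if $\mathcal{D}(\mathbf{A})=\mathcal{D}(\mathbf{A}^\star)$ and $\|\mathbf{A}g\|_\mu=\|\mathbf{A}^\star g\|_\mu$ for all $g\in\mathcal{D}(\mathbf{A})$. Energies: $\mathrm{E}_0(f,g)=(f,g)_\mu-(f,\mathbf{1})_\mu(g,\mathbf{1})_\mu$ and $\mathrm{E}_{n+1}(f,g)=-\mathrm{E}_n(\mathbf{A}f,g)-\mathrm{E}_n(f,\mathbf{A}g)$. *)

theory Defs
  imports "HOL-Probability.Probability" "HOL-Library.Landau_Symbols"
begin

(* The state space is a type 'z carrying a topology that is assumed compact and metrizable.
   By compactness, the type 'z \<Rightarrow>\<^sub>C real of bounded continuous functions with the
   supremum norm contains all real-valued continuous functions, i.e. it is C(Z). *)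

definition markov_operator ::
    "(('z::topological_space \<Rightarrow>\<^sub>C real) \<Rightarrow>\<^sub>L ('z \<Rightarrow>\<^sub>C real)) \<Rightarrow> bool" where
  "markov_operator M \<longleftrightarrow>
     blinfun_apply M (const_bcontfun 1) = const_bcontfun 1 \<and>
     (\<forall>g. (\<forall>z. 0 \<le> apply_bcontfun g z) \<longrightarrow>
          (\<forall>z. 0 \<le> apply_bcontfun (blinfun_apply M g) z))"

definition markov_semigroup ::
    "(real \<Rightarrow> (('z::topological_space \<Rightarrow>\<^sub>C real) \<Rightarrow>\<^sub>L ('z \<Rightarrow>\<^sub>C real))) \<Rightarrow> bool" where
  "markov_semigroup T \<longleftrightarrow>
     (\<forall>t\<ge>0. markov_operator (T t)) \<and>
     T 0 = id_blinfun \<and>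
     (\<forall>s\<ge>0. \<forall>t\<ge>0. T (s + t) = T s o\<^sub>L T t) \<and>
     (\<forall>g. continuous_on {0..} (\<lambda>t. blinfun_apply (T t) g))"

definition stationary_measure ::
    "(real \<Rightarrow> (('z::topological_space \<Rightarrow>\<^sub>C real) \<Rightarrow>\<^sub>L ('z \<Rightarrow>\<^sub>C real))) \<Rightarrow>
     'z measure \<Rightarrow> bool" where
  "stationary_measure T \<mu> \<longleftrightarrow>
     sets \<mu> = sets borel \<and> prob_space \<mu> \<and>
     (\<forall>g. \<forall>t\<ge>0. (\<integral>z. apply_bcontfun (blinfun_apply (T t) g) z \<partial>\<mu>) =
                 (\<integral>z. apply_bcontfun g z \<partial>\<mu>))"

(* L^2(\<mu>) is represented by the square-integrable functions themselves, equality of elements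
   being equality almost everywhere. Every notion below depends on its arguments only up to
   a.e. equality. Operators return a representative picked by SOME; the property it is picked by
   determines it up to a.e. equality and depends only on the a.e. class of the argument, so a.e.
   equal arguments give the same result. Domains of operators are closed under a.e. equality of
   measurable functions. *)

definition L2 :: "'z measure \<Rightarrow> ('z \<Rightarrow> real) set" where
  "L2 \<mu> = {f \<in> borel_measurable \<mu>. integrable \<mu> (\<lambda>z. (f z)\<^sup>2)}"

definition l2_inner :: "'z measure \<Rightarrow> ('z \<Rightarrow> real) \<Rightarrow> ('z \<Rightarrow> real) \<Rightarrow> real" where
  "l2_inner \<mu> f g = (\<integral>z. f z * g z \<partial>\<mu>)"

definition l2_norm :: "'z measure \<Rightarrow> ('z \<Rightarrow> real) \<Rightarrow> real" where
  "l2_norm \<mu> f = sqrt (l2_inner \<mu> f f)"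

(* The extension of T t to L^2(\<mu>) by continuity from the dense subspace C(Z): if continuous
   functions u k converge to f in L^2(\<mu>), then T t f is the L^2(\<mu>)-limit of T t (u k). *)

definition l2_extension ::
    "'z measure \<Rightarrow> (real \<Rightarrow> (('z::topological_space \<Rightarrow>\<^sub>C real) \<Rightarrow>\<^sub>L ('z \<Rightarrow>\<^sub>C real))) \<Rightarrow>
     real \<Rightarrow> ('z \<Rightarrow> real) \<Rightarrow> ('z \<Rightarrow> real)" where
  "l2_extension \<mu> T t f = (SOME h. h \<in> L2 \<mu> \<and>
     (\<exists>u :: nat \<Rightarrow> ('z \<Rightarrow>\<^sub>C real).
        (\<lambda>k. l2_norm \<mu> (\<lambda>z. apply_bcontfun (u k) z - f z)) \<longlonglongrightarrow> 0 \<and>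
        (\<lambda>k. l2_norm \<mu> (\<lambda>z. apply_bcontfun (blinfun_apply (T t) (u k)) z - h z)) \<longlonglongrightarrow> 0))"

definition is_generator_value ::
    "'z measure \<Rightarrow> (real \<Rightarrow> ('z \<Rightarrow> real) \<Rightarrow> ('z \<Rightarrow> real)) \<Rightarrow>
     ('z \<Rightarrow> real) \<Rightarrow> ('z \<Rightarrow> real) \<Rightarrow> bool" where
  "is_generator_value \<mu> S f h \<longleftrightarrow> f \<in> L2 \<mu> \<and> h \<in> L2 \<mu> \<and>
     ((\<lambda>t. l2_norm \<mu> (\<lambda>z. (S t f z - f z) / t - h z)) \<longlongrightarrow> 0) (at_right 0)"

definition generator_dom ::
    "'z measure \<Rightarrow> (real \<Rightarrow> ('z \<Rightarrow> real) \<Rightarrow> ('z \<Rightarrow> real)) \<Rightarrow> ('z \<Rightarrow> real) set" where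
  "generator_dom \<mu> S = {f. \<exists>h. is_generator_value \<mu> S f h}"

definition generator ::
    "'z measure \<Rightarrow> (real \<Rightarrow> ('z \<Rightarrow> real) \<Rightarrow> ('z \<Rightarrow> real)) \<Rightarrow>
     ('z \<Rightarrow> real) \<Rightarrow> ('z \<Rightarrow> real)" where
  "generator \<mu> S f = (SOME h. is_generator_value \<mu> S f h)"

(* Below, an unbounded operator on L^2(\<mu>) is given by its domain D and its action A on D;
   the values of A outside D are irrelevant. *)

primrec power_dom ::
    "'z measure \<Rightarrow> ('z \<Rightarrow> real) set \<Rightarrow> (('z \<Rightarrow> real) \<Rightarrow> ('z \<Rightarrow> real)) \<Rightarrow>
     nat \<Rightarrow> ('z \<Rightarrow> real) set" where
  "power_dom \<mu> D A 0 = L2 \<mu>"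
| "power_dom \<mu> D A (Suc n) = {f \<in> D. A f \<in> power_dom \<mu> D A n}"

definition smooth_dom ::
    "'z measure \<Rightarrow> ('z \<Rightarrow> real) set \<Rightarrow> (('z \<Rightarrow> real) \<Rightarrow> ('z \<Rightarrow> real)) \<Rightarrow>
     ('z \<Rightarrow> real) set" where
  "smooth_dom \<mu> D A = (\<Inter>n. power_dom \<mu> D A n)"

definition is_adjoint_value ::
    "'z measure \<Rightarrow> ('z \<Rightarrow> real) set \<Rightarrow> (('z \<Rightarrow> real) \<Rightarrow> ('z \<Rightarrow> real)) \<Rightarrow>
     ('z \<Rightarrow> real) \<Rightarrow> ('z \<Rightarrow> real) \<Rightarrow> bool" where
  "is_adjoint_value \<mu> D A f h \<longleftrightarrow> f \<in> L2 \<mu> \<and> h \<in> L2 \<mu> \<and>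
     (\<forall>u\<in>D. l2_inner \<mu> (A u) f = l2_inner \<mu> u h)"

definition adjoint_dom ::
    "'z measure \<Rightarrow> ('z \<Rightarrow> real) set \<Rightarrow> (('z \<Rightarrow> real) \<Rightarrow> ('z \<Rightarrow> real)) \<Rightarrow>
     ('z \<Rightarrow> real) set" where
  "adjoint_dom \<mu> D A = {f. \<exists>h. is_adjoint_value \<mu> D A f h}"

definition adjoint_op ::
    "'z measure \<Rightarrow> ('z \<Rightarrow> real) set \<Rightarrow> (('z \<Rightarrow> real) \<Rightarrow> ('z \<Rightarrow> real)) \<Rightarrow>
     ('z \<Rightarrow> real) \<Rightarrow> ('z \<Rightarrow> real)" where
  "adjoint_op \<mu> D A f = (SOME h. is_adjoint_value \<mu> D A f h)"

definition normal_operator ::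
    "'z measure \<Rightarrow> ('z \<Rightarrow> real) set \<Rightarrow> (('z \<Rightarrow> real) \<Rightarrow> ('z \<Rightarrow> real)) \<Rightarrow> bool" where
  "normal_operator \<mu> D A \<longleftrightarrow> D = adjoint_dom \<mu> D A \<and>
     (\<forall>g\<in>D. l2_norm \<mu> (A g) = l2_norm \<mu> (adjoint_op \<mu> D A g))"

(* g solves g' = A g on [0,\<infinity>) with g(0) = g0; the derivative is taken in L^2(\<mu>)
   (one-sided at 0). *)

definition solves_cauchy_problem ::
    "'z measure \<Rightarrow> ('z \<Rightarrow> real) set \<Rightarrow> (('z \<Rightarrow> real) \<Rightarrow> ('z \<Rightarrow> real)) \<Rightarrow>
     ('z \<Rightarrow> real) \<Rightarrow> (real \<Rightarrow> 'z \<Rightarrow> real) \<Rightarrow> bool" where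
  "solves_cauchy_problem \<mu> D A g0 g \<longleftrightarrow>
     (AE z in \<mu>. g 0 z = g0 z) \<and>
     (\<forall>t\<ge>0. g t \<in> D \<and>
        ((\<lambda>s. l2_norm \<mu> (\<lambda>z. (g s z - g t z) / (s - t) - A (g t) z)) \<longlongrightarrow> 0)
          (at t within {0..}))"

primrec energy ::
    "'z measure \<Rightarrow> (('z \<Rightarrow> real) \<Rightarrow> ('z \<Rightarrow> real)) \<Rightarrow> nat \<Rightarrow>
     ('z \<Rightarrow> real) \<Rightarrow> ('z \<Rightarrow> real) \<Rightarrow> real" where
  "energy \<mu> A 0 = (\<lambda>f g. l2_inner \<mu> f g -
     l2_inner \<mu> f (\<lambda>_. 1) * l2_inner \<mu> g (\<lambda>_. 1))"
| "energy \<mu> A (Suc n) = (\<lambda>f g. - energy \<mu> A n (A f) g - energy \<mu> A n f (A g))"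

end

theory Submission
  imports Defs "HOL-Library.Function_Algebras"
begin

text \<open>
  On \<open>\<D>(A\<^sup>\<infinity>)\<close> one has \<open>E\<^sub>n\<^sub>+\<^sub>1(f, g) = E\<^sub>n(B f, g)\<close> with \<open>B = - (A + A\<^sup>\<star>)\<close>; for this
  \<open>B\<close> has to map \<open>\<D>(A\<^sup>\<infinity>)\<close> into itself and to commute with \<open>A\<close>, which is where normality
  enters. Hence every form \<open>E\<^sub>n\<close> is positive semidefinite and the Cauchy-Schwarz inequality for \<open>E\<^sub>n\<close>
  gives the log-convexity \<open>e\<^sub>n\<^sub>+\<^sub>1\<^sup>2 \<le> e\<^sub>n e\<^sub>n\<^sub>+\<^sub>2\<close>, so that \<open>e\<^sub>n\<^sup>n\<^sup>+\<^sup>1 \<le> e\<^sub>n\<^sub>+\<^sub>1\<^sup>n e\<^sub>0\<close>. As \<open>e\<^sub>n' = - e\<^sub>n\<^sub>+\<^sub>1\<close>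
  along the flow and \<open>e\<^sub>0\<close> decreases, \<open>e\<^sub>n\<close> satisfies a differential inequality that bounds the
  derivative of \<open>e\<^sub>n\<close> to the power \<open>-1/n\<close> from below by the constant \<open>e\<^sub>0(0)\<close> to the power \<open>-1/n\<close>, divided
  by \<open>n\<close>.
\<close>

section \<open>Semi-inner product spaces\<close>

text \<open>Normality is given only as equality of two domains and of two norms. The price is
  closedness of the generator and completeness of L^2, so both are proved here. The second obstacle
  is that operators act on functions and return arbitrary representatives. Linearity, the semigroup
  law and commutation hold only modulo null vectors, so the operator theory is developed over a
  possibly degenerate inner product and then applied to the extension of \<open>T\<close>. Third, g
  is an arbitrary solution, and its regularity at later times comes from uniqueness, which
  identifies it with the orbit of g0 under the semigroup. The exponent -1/n has a simple origin:
  n-th roots in the interpolation inequality give -e_n' >= e_0(0)^(-1/n) e_n^(1+1/n), and dividing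
  by n e_n^(1+1/n) turns the left side into the derivative of e_n^(-1/n).\<close>

lemma quadratic_nonneg_discriminant:
  fixes a b c :: real
  assumes "\<And>t. 0 \<le> a + 2 * t * b + t\<^sup>2 * c"
  shows "b\<^sup>2 \<le> a * c"
proof (cases "c = 0")
  case True
  have "b = 0"
  proof (rule ccontr)
    assume b: "b \<noteq> 0"
    \<comment> \<open>The linear polynomial takes the value -1 at this point.\<close>
    have "0 \<le> a + 2 * (- (a + 1) / (2 * b)) * b"
      using assms[of "- (a + 1) / (2 * b)"] True by simp
    also have "\<dots> = -1" using b by (simp add: field_simps)
    finally show False by simp
  qed
  then show ?thesis using True by simp
next
  case False
  have "c \<ge> 0"
  proof (rule ccontr)
    assume "\<not> c \<ge> 0"
    then have c: "c < 0" by simp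
    \<comment> \<open>Chosen so that \<open>t \<ge> 1\<close> and
      \<open>2 * b + t * c \<le> c - \<bar>a\<bar> < 0\<close>; the quadratic is then at most
      \<open>a + c - \<bar>a\<bar>\<close>, which is negative.\<close>
    define t where "t = 1 + (\<bar>a\<bar> + 2 * \<bar>b\<bar>) / (- c)"
    have t1: "t \<ge> 1" using c by (simp add: t_def divide_nonneg_neg divide_nonpos_neg)
    have "t * (- c) = - c + (\<bar>a\<bar> + 2 * \<bar>b\<bar>)" using c by (simp add: t_def field_simps)
    then have "t * c = c - (\<bar>a\<bar> + 2 * \<bar>b\<bar>)" by simp
    have "a + 2 * t * b + t\<^sup>2 * c = a + t * (2 * b + t * c)"
      by (simp add: power2_eq_square algebra_simps)
    also have "\<dots> \<le> a + t * (c - \<bar>a\<bar>)"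
      using t1 \<open>t * c = _\<close> by (intro add_left_mono mult_left_mono) auto
    also have "\<dots> \<le> a + 1 * (c - \<bar>a\<bar>)"
      using t1 c by (intro add_left_mono mult_right_mono_neg) auto
    also have "\<dots> < 0" using c by auto
    finally show False using assms[of t] by simp
  qed
  with False have c: "c > 0" by simp
  have "0 \<le> (a + 2 * (- b / c) * b + (- b / c)\<^sup>2 * c) * c"
    using assms[of "- b / c"] c by simp
  also have "\<dots> = a * c - b\<^sup>2" using c by (simp add: field_simps power2_eq_square)
  finally show ?thesis by simp
qed

text \<open>The form may be degenerate, so that square-integrable functions can be used without passing
  to classes: equality of vectors is replaced by vanishing of the seminorm of the difference.\<close>

locale semi_inner =
  fixes H :: "'v::real_vector set" and ip :: "'v \<Rightarrow> 'v \<Rightarrow> real"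
  assumes subspace_H: "subspace H"
    and ip_add_left: "\<lbrakk>x \<in> H; y \<in> H; z \<in> H\<rbrakk> \<Longrightarrow> ip (x + y) z = ip x z + ip y z"
    and ip_scale_left: "\<lbrakk>x \<in> H; z \<in> H\<rbrakk> \<Longrightarrow> ip (a *\<^sub>R x) z = a * ip x z"
    and ip_commute: "\<lbrakk>x \<in> H; y \<in> H\<rbrakk> \<Longrightarrow> ip x y = ip y x"
    and ip_ge_0: "x \<in> H \<Longrightarrow> 0 \<le> ip x x"
begin

lemma H_closed [simp, intro]:
  "0 \<in> H"
  "\<lbrakk>x \<in> H; y \<in> H\<rbrakk> \<Longrightarrow> x + y \<in> H"
  "\<lbrakk>x \<in> H; y \<in> H\<rbrakk> \<Longrightarrow> x - y \<in> H"
  "x \<in> H \<Longrightarrow> a *\<^sub>R x \<in> H"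
  "x \<in> H \<Longrightarrow> - x \<in> H"
  using subspace_H by (auto simp: subspace_0 subspace_add subspace_diff subspace_scale subspace_neg)

lemma ip_minus_left: "\<lbrakk>x \<in> H; z \<in> H\<rbrakk> \<Longrightarrow> ip (- x) z = - ip x z"
  using ip_scale_left[of x z "-1"] by simp

lemma ip_diff_left: "\<lbrakk>x \<in> H; y \<in> H; z \<in> H\<rbrakk> \<Longrightarrow> ip (x - y) z = ip x z - ip y z"
  using ip_add_left[of x "- y" z] by (simp add: ip_minus_left)

lemma ip_zero_left: "z \<in> H \<Longrightarrow> ip 0 z = 0"
  using ip_scale_left[of 0 z 0] by simp

lemma ip_add_right: "\<lbrakk>x \<in> H; y \<in> H; z \<in> H\<rbrakk> \<Longrightarrow> ip z (x + y) = ip z x + ip z y"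
  by (simp add: ip_commute[of z] ip_add_left)

lemma ip_zero_right: "z \<in> H \<Longrightarrow> ip z 0 = 0"
  by (simp add: ip_commute[of z 0] ip_zero_left)

lemma ip_scale_right: "\<lbrakk>x \<in> H; z \<in> H\<rbrakk> \<Longrightarrow> ip z (a *\<^sub>R x) = a * ip z x"
  by (simp add: ip_commute[of z] ip_scale_left)

lemma ip_diff_right: "\<lbrakk>x \<in> H; y \<in> H; z \<in> H\<rbrakk> \<Longrightarrow> ip z (x - y) = ip z x - ip z y"
  by (simp add: ip_commute[of z] ip_diff_left)

lemma ip_minus_right: "\<lbrakk>x \<in> H; z \<in> H\<rbrakk> \<Longrightarrow> ip z (- x) = - ip z x"
  by (simp add: ip_commute[of z] ip_minus_left)

lemmas ip_simps = ip_add_left ip_add_right ip_scale_left ip_scale_right ip_diff_left ip_diff_right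
  ip_minus_left ip_minus_right

section \<open>Seminorm, equality modulo null vectors, convergence\<close>

definition nrm :: "'v \<Rightarrow> real" where "nrm x = sqrt (ip x x)"

definition eqv :: "'v \<Rightarrow> 'v \<Rightarrow> bool" (infix "\<doteq>" 50)
  where "x \<doteq> y \<longleftrightarrow> nrm (x - y) = 0"

text \<open>Membership in \<open>H\<close> is demanded only eventually, because a semigroup is
  controlled only at nonnegative times; it is demanded at all because the inequalities for
  \<open>nrm\<close> hold only on \<open>H\<close>.\<close>

definition conv :: "('a \<Rightarrow> 'v) \<Rightarrow> 'v \<Rightarrow> 'a filter \<Rightarrow> bool" where
  "conv X x F \<longleftrightarrow> x \<in> H \<and> (\<forall>\<^sub>F t in F. X t \<in> H) \<and> ((\<lambda>t. nrm (X t - x)) \<longlongrightarrow> 0) F"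

lemma nrm_ge_0 [simp]: "x \<in> H \<Longrightarrow> 0 \<le> nrm x"
  by (simp add: nrm_def ip_ge_0)

lemma nrm_sq: "x \<in> H \<Longrightarrow> (nrm x)\<^sup>2 = ip x x"
  by (simp add: nrm_def ip_ge_0)

lemma Cauchy_Schwarz_sq:
  assumes "x \<in> H" "y \<in> H"
  shows "(ip x y)\<^sup>2 \<le> ip x x * ip y y"
proof (rule quadratic_nonneg_discriminant)
  fix t
  have "0 \<le> ip (x + t *\<^sub>R y) (x + t *\<^sub>R y)" using assms by (intro ip_ge_0) auto
  also have "\<dots> = ip x x + 2 * t * ip x y + t\<^sup>2 * ip y y"
    using assms by (simp add: ip_simps ip_commute[of y x] power2_eq_square algebra_simps)
  finally show "0 \<le> ip x x + 2 * t * ip x y + t\<^sup>2 * ip y y" .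
qed

lemma Cauchy_Schwarz:
  assumes "x \<in> H" "y \<in> H"
  shows "\<bar>ip x y\<bar> \<le> nrm x * nrm y"
proof -
  have "sqrt ((ip x y)\<^sup>2) \<le> sqrt (ip x x * ip y y)"
    using Cauchy_Schwarz_sq[OF assms] by (rule real_sqrt_le_mono)
  then show ?thesis by (simp add: nrm_def real_sqrt_mult)
qed

lemma nrm_triangle:
  assumes "x \<in> H" "y \<in> H"
  shows "nrm (x + y) \<le> nrm x + nrm y"
proof (rule power2_le_imp_le)
  have "(nrm (x + y))\<^sup>2 = ip x x + 2 * ip x y + ip y y"
    using assms by (simp add: nrm_sq ip_simps ip_commute[of y x])
  also have "\<dots> \<le> ip x x + 2 * (nrm x * nrm y) + ip y y"
    using Cauchy_Schwarz[OF assms] by auto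
  also have "\<dots> = (nrm x + nrm y)\<^sup>2"
    using assms by (simp add: power2_sum nrm_sq)
  finally show "(nrm (x + y))\<^sup>2 \<le> (nrm x + nrm y)\<^sup>2" .
qed (use assms in auto)

lemma nrm_scale: "x \<in> H \<Longrightarrow> nrm (a *\<^sub>R x) = \<bar>a\<bar> * nrm x"
  by (simp add: nrm_def ip_simps real_sqrt_mult flip: mult.assoc power2_eq_square)

lemma nrm_minus: "x \<in> H \<Longrightarrow> nrm (- x) = nrm x"
  using nrm_scale[of x "-1"] by simp

lemma nrm_diff_commute: "\<lbrakk>x \<in> H; y \<in> H\<rbrakk> \<Longrightarrow> nrm (x - y) = nrm (y - x)"
  using nrm_minus[of "x - y"] by simp

lemma nrm_zero [simp]: "nrm 0 = 0"
  using nrm_scale[of 0 0] by simp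

lemma nrm_triangle_diff:
  assumes "x \<in> H" "y \<in> H" "z \<in> H"
  shows "nrm (x - z) \<le> nrm (x - y) + nrm (y - z)"
  using nrm_triangle[of "x - y" "y - z"] assms by simp

lemma eqv_refl [simp]: "x \<doteq> x"
  by (simp add: eqv_def)

lemma eqv_sym: "\<lbrakk>x \<in> H; y \<in> H; x \<doteq> y\<rbrakk> \<Longrightarrow> y \<doteq> x"
  by (simp add: eqv_def nrm_diff_commute)

lemma eqv_trans:
  assumes "x \<in> H" "y \<in> H" "z \<in> H" "x \<doteq> y" "y \<doteq> z"
  shows "x \<doteq> z"
proof -
  have "nrm (x - z) \<le> 0" using nrm_triangle_diff[of x y z] assms by (simp add: eqv_def)
  moreover have "0 \<le> nrm (x - z)" using assms by simp
  ultimately show ?thesis unfolding eqv_def by linarith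
qed

lemma ip_cong_left: "\<lbrakk>x \<in> H; y \<in> H; z \<in> H; x \<doteq> y\<rbrakk> \<Longrightarrow> ip x z = ip y z"
  using Cauchy_Schwarz[of "x - y" z] by (simp add: eqv_def ip_simps)

lemma ip_cong_right: "\<lbrakk>x \<in> H; y \<in> H; z \<in> H; x \<doteq> y\<rbrakk> \<Longrightarrow> ip z x = ip z y"
  using ip_cong_left[of x y z] by (simp add: ip_commute[of z])

lemma nrm_cong: "\<lbrakk>x \<in> H; y \<in> H; x \<doteq> y\<rbrakk> \<Longrightarrow> nrm x = nrm y"
  using ip_cong_left[of x y x] ip_cong_right[of x y y] by (simp add: nrm_def)

lemma eqv_zero_iff: "x \<doteq> 0 \<longleftrightarrow> nrm x = 0"
  by (simp add: eqv_def)

lemma eqv_ip_zero: "x \<in> H \<Longrightarrow> ip x x = 0 \<Longrightarrow> x \<doteq> 0"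
  by (simp add: eqv_def nrm_def)

lemma eqv_scale: "\<lbrakk>x \<in> H; y \<in> H; x \<doteq> y\<rbrakk> \<Longrightarrow> a *\<^sub>R x \<doteq> a *\<^sub>R y"
  using nrm_scale[of "x - y" a] by (simp add: eqv_def scaleR_diff_right)

lemma eqv_minus: "\<lbrakk>x \<in> H; y \<in> H; x \<doteq> y\<rbrakk> \<Longrightarrow> - x \<doteq> - y"
  using eqv_scale[of x y "-1"] by simp

lemma eqv_add:
  assumes "x \<in> H" "y \<in> H" "x' \<in> H" "y' \<in> H" "x \<doteq> x'" "y \<doteq> y'"
  shows "x + y \<doteq> x' + y'"
proof -
  have "nrm ((x - x') + (y - y')) \<le> nrm (x - x') + nrm (y - y')"
    using assms by (intro nrm_triangle) auto
  then have "nrm ((x + y) - (x' + y')) \<le> 0" using assms by (simp add: eqv_def add_diff_add)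
  moreover have "0 \<le> nrm ((x + y) - (x' + y'))" using assms by (intro nrm_ge_0) auto
  ultimately show ?thesis unfolding eqv_def by linarith
qed

lemma eqv_diff:
  assumes "x \<in> H" "y \<in> H" "x' \<in> H" "y' \<in> H" "x \<doteq> x'" "y \<doteq> y'"
  shows "x - y \<doteq> x' - y'"
  using eqv_add[of x "- y" x' "- y'"] eqv_minus[of y y'] assms by simp

lemma convI:
  assumes "x \<in> H" "\<forall>\<^sub>F t in F. X t \<in> H" "\<forall>\<^sub>F t in F. nrm (X t - x) \<le> r t" "(r \<longlongrightarrow> 0) F"
  shows "conv X x F"
proof -
  have "((\<lambda>t. nrm (X t - x)) \<longlongrightarrow> 0) F"
  proof (rule tendsto_sandwich[OF _ assms(3) tendsto_const assms(4)])
    show "\<forall>\<^sub>F t in F. 0 \<le> nrm (X t - x)"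
      using assms(2) by eventually_elim (simp add: assms(1))
  qed
  then show ?thesis using assms by (simp add: conv_def)
qed

lemma conv_const: "x \<in> H \<Longrightarrow> conv (\<lambda>_. x) x F"
  by (simp add: conv_def)

lemma conv_add:
  assumes "conv X x F" "conv Y y F"
  shows "conv (\<lambda>t. X t + Y t) (x + y) F"
proof (rule convI)
  have H: "x \<in> H" "y \<in> H" and ev: "\<forall>\<^sub>F t in F. X t \<in> H" "\<forall>\<^sub>F t in F. Y t \<in> H"
    using assms by (auto simp: conv_def)
  show "x + y \<in> H" using H by simp
  show "\<forall>\<^sub>F t in F. X t + Y t \<in> H" using ev by eventually_elim auto
  show "\<forall>\<^sub>F t in F. nrm ((X t + Y t) - (x + y)) \<le> nrm (X t - x) + nrm (Y t - y)"
    using ev by eventually_elim (use H in \<open>auto simp: add_diff_add intro!: nrm_triangle\<close>)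
  show "((\<lambda>t. nrm (X t - x) + nrm (Y t - y)) \<longlongrightarrow> 0) F"
    using tendsto_add[of _ 0 F _ 0] assms by (auto simp: conv_def)
qed

lemma conv_scale:
  assumes "conv X x F" "(a \<longlongrightarrow> b) F"
  shows "conv (\<lambda>t. a t *\<^sub>R X t) (b *\<^sub>R x) F"
proof (rule convI)
  have ev: "\<forall>\<^sub>F t in F. X t \<in> H" and x: "x \<in> H" using assms by (auto simp: conv_def)
  show "\<forall>\<^sub>F t in F. nrm (a t *\<^sub>R X t - b *\<^sub>R x) \<le> \<bar>a t\<bar> * nrm (X t - x) + \<bar>a t - b\<bar> * nrm x"
    using ev
  proof eventually_elim
    fix t assume t: "X t \<in> H"
    have "a t *\<^sub>R X t - b *\<^sub>R x = a t *\<^sub>R (X t - x) + (a t - b) *\<^sub>R x"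
      by (simp add: algebra_simps)
    then show "nrm (a t *\<^sub>R X t - b *\<^sub>R x) \<le> \<bar>a t\<bar> * nrm (X t - x) + \<bar>a t - b\<bar> * nrm x"
      using nrm_triangle[of "a t *\<^sub>R (X t - x)" "(a t - b) *\<^sub>R x"] t x by (simp add: nrm_scale)
  qed
  show "\<forall>\<^sub>F t in F. a t *\<^sub>R X t \<in> H" using ev by eventually_elim auto
  show "b *\<^sub>R x \<in> H" using x by simp
  have "((\<lambda>t. \<bar>a t\<bar> * nrm (X t - x) + \<bar>a t - b\<bar> * nrm x) \<longlongrightarrow> \<bar>b\<bar> * 0 + \<bar>b - b\<bar> * nrm x) F"
    using assms by (intro tendsto_intros) (auto simp: conv_def)
  then show "((\<lambda>t. \<bar>a t\<bar> * nrm (X t - x) + \<bar>a t - b\<bar> * nrm x) \<longlongrightarrow> 0) F" by simp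
qed

lemma conv_diff:
  assumes "conv X x F" "conv Y y F"
  shows "conv (\<lambda>t. X t - Y t) (x - y) F"
  using conv_add[OF assms(1) conv_scale[OF assms(2) tendsto_const[of "-1"]]] by simp

lemma conv_eqv:
  assumes "conv X x F" "\<forall>\<^sub>F t in F. X' t \<in> H \<and> X' t \<doteq> X t" "x' \<in> H" "x \<doteq> x'"
  shows "conv X' x' F"
proof (rule convI)
  have x: "x \<in> H" using assms by (simp add: conv_def)
  have "\<forall>\<^sub>F t in F. X t \<in> H" using assms by (simp add: conv_def)
  with assms(2) show "\<forall>\<^sub>F t in F. nrm (X' t - x') \<le> nrm (X t - x)"
  proof eventually_elim
    fix t assume "X' t \<in> H \<and> X' t \<doteq> X t" "X t \<in> H"
    then have "X' t - x' \<doteq> X t - x" using assms(3,4) x by (intro eqv_diff) (auto intro: eqv_sym)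
    then show "nrm (X' t - x') \<le> nrm (X t - x)"
      using nrm_cong[of "X' t - x'" "X t - x"] \<open>X' t \<in> H \<and> _\<close> \<open>X t \<in> H\<close> x assms(3) by auto
  qed
qed (use assms in \<open>auto simp: conv_def elim: eventually_mono\<close>)

lemma conv_ip:
  assumes "conv X x F" "conv Y y F"
  shows "((\<lambda>t. ip (X t) (Y t)) \<longlongrightarrow> ip x y) F"
proof (rule LIM_zero_cancel, rule Lim_null_comparison)
  have x: "x \<in> H" and y: "y \<in> H" and "\<forall>\<^sub>F t in F. X t \<in> H" "\<forall>\<^sub>F t in F. Y t \<in> H"
    using assms by (auto simp: conv_def)
  from this(3,4) show "\<forall>\<^sub>F t in F. norm (ip (X t) (Y t) - ip x y) \<le>
      nrm (X t - x) * nrm (Y t - y) + nrm (X t - x) * nrm y + nrm x * nrm (Y t - y)"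
  proof eventually_elim
    fix t assume t: "X t \<in> H" "Y t \<in> H"
    have "ip (X t) (Y t) - ip x y = ip (X t - x) (Y t - y) + ip (X t - x) y + ip x (Y t - y)"
      using t x y by (simp add: ip_simps)
    then show "norm (ip (X t) (Y t) - ip x y) \<le>
      nrm (X t - x) * nrm (Y t - y) + nrm (X t - x) * nrm y + nrm x * nrm (Y t - y)"
      using Cauchy_Schwarz[of "X t - x" "Y t - y"] Cauchy_Schwarz[of "X t - x" y]
        Cauchy_Schwarz[of x "Y t - y"] t x y by auto
  qed
  have "((\<lambda>t. nrm (X t - x) * nrm (Y t - y) + nrm (X t - x) * nrm y + nrm x * nrm (Y t - y))
      \<longlongrightarrow> 0 * 0 + 0 * nrm y + nrm x * 0) F"
    using assms by (intro tendsto_intros) (auto simp: conv_def)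
  then show "((\<lambda>t. nrm (X t - x) * nrm (Y t - y) + nrm (X t - x) * nrm y + nrm x * nrm (Y t - y))
      \<longlongrightarrow> 0) F" by simp
qed

lemma conv_nrm:
  assumes "conv X x F"
  shows "((\<lambda>t. nrm (X t)) \<longlongrightarrow> nrm x) F"
  unfolding nrm_def by (intro tendsto_real_sqrt conv_ip assms)

lemma conv_unique:
  assumes "F \<noteq> bot" "conv X x F" "conv X y F"
  shows "x \<doteq> y"
proof -
  have xy: "x \<in> H" "y \<in> H" using assms by (auto simp: conv_def)
  have "((\<lambda>t. ip (X t - X t) (X t - X t)) \<longlongrightarrow> ip (x - y) (x - y)) F"
    using conv_ip[OF conv_diff[OF assms(2,3)] conv_diff[OF assms(2,3)]] .
  then have "((\<lambda>_. 0) \<longlongrightarrow> ip (x - y) (x - y)) F" by (simp add: ip_zero_left)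
  then have "ip (x - y) (x - y) = 0" using assms(1) tendsto_unique[OF _ _ tendsto_const] by blast
  then show ?thesis by (simp add: eqv_def nrm_def)
qed

text \<open>The classical argument by a minimizing sequence. Completeness is asked of
  \<open>G\<close> alone, with limits in \<open>G\<close>: for the graph of a generator this is
  exactly what closedness provides.\<close>

lemma projection:
  assumes G: "subspace G" "G \<subseteq> H" and x: "x \<in> H"
    and complete: "\<And>X. (\<And>n. X n \<in> G) \<Longrightarrow> (\<And>e. e > 0 \<Longrightarrow> \<exists>M. \<forall>m\<ge>M. \<forall>n\<ge>M. nrm (X m - X n) < e)
       \<Longrightarrow> \<exists>y\<in>G. conv X y sequentially"
  shows "\<exists>y\<in>G. \<forall>u\<in>G. ip (x - y) u = 0"
proof -
  define q where "q y = ip (x - y) (x - y)" for y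
  have GH: "y \<in> H" if "y \<in> G" for y using G that by auto
  have q0: "0 \<le> q y" if "y \<in> G" for y
    unfolding q_def using x GH[OF that] by (intro ip_ge_0) auto
  define d where "d = Inf (q ` G)"
  have ne: "q ` G \<noteq> {}" using G by (auto simp: subspace_def)
  have bdd: "bdd_below (q ` G)" using q0 by (intro bdd_belowI[of _ 0]) auto
  have d_le: "d \<le> q y" if "y \<in> G" for y
    unfolding d_def using that bdd by (intro cInf_lower) auto
  have "\<exists>y\<in>G. q y < d + 1 / real (Suc n)" for n
    using cInf_lessD[OF ne, of "d + 1 / real (Suc n)"] by (auto simp: d_def)
  then obtain Y where Y: "\<And>n. Y n \<in> G" "\<And>n. q (Y n) < d + 1 / real (Suc n)" by metis
  \<comment> \<open>Parallelogram law for \<open>x - Y m\<close> and \<open>x - Y n\<close>: the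
    midpoint lies in \<open>G\<close>, so \<open>q\<close> is at least \<open>d\<close> there and
    the terms in \<open>d\<close> cancel.\<close>
  have par: "(nrm (Y m - Y n))\<^sup>2 \<le> 2 / real (Suc m) + 2 / real (Suc n)" for m n
  proof -
    have mid: "(1/2) *\<^sub>R (Y m + Y n) \<in> G" using G Y by (intro subspace_scale subspace_add) auto
    have "(nrm (Y m - Y n))\<^sup>2 = 2 * q (Y m) + 2 * q (Y n) - 4 * q ((1/2) *\<^sub>R (Y m + Y n))"
      using x GH[OF Y(1)] unfolding q_def
      by (simp add: nrm_sq ip_simps ip_commute[of "Y m" x] ip_commute[of "Y n" x] ip_commute[of "Y n" "Y m"] algebra_simps)
    also have "\<dots> \<le> 2 / real (Suc m) + 2 / real (Suc n)"
      using d_le[OF mid] Y(2)[of m] Y(2)[of n] by simp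
    finally show ?thesis .
  qed
  have "\<exists>y\<in>G. conv Y y sequentially"
  proof (rule complete)
    fix e :: real assume e: "e > 0"
    obtain M where M: "1 / real (Suc M) < e\<^sup>2 / 4"
      using reals_Archimedean[of "e\<^sup>2 / 4"] e by (auto simp: inverse_eq_divide)
    show "\<exists>M. \<forall>m\<ge>M. \<forall>n\<ge>M. nrm (Y m - Y n) < e"
    proof (intro exI allI impI)
      fix m n assume mn: "M \<le> m" "M \<le> n"
      have "1 / real (Suc m) \<le> 1 / real (Suc M)" "1 / real (Suc n) \<le> 1 / real (Suc M)"
        using mn by (auto intro!: divide_left_mono)
      then have "(nrm (Y m - Y n))\<^sup>2 < e\<^sup>2" using par[of m n] M by simp
      then show "nrm (Y m - Y n) < e" using e by (simp add: power2_less_imp_less)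
    qed
  qed (rule Y(1))
  then obtain y where y: "y \<in> G" "conv Y y sequentially" by blast
  have "(\<lambda>n. q (Y n)) \<longlonglongrightarrow> q y"
    unfolding q_def using x y by (intro conv_ip conv_diff conv_const)
  moreover have "(\<lambda>n. d + 1 / real (Suc n)) \<longlonglongrightarrow> d + 0"
    by (intro tendsto_add tendsto_const LIMSEQ_Suc lim_1_over_n)
  ultimately have qy: "q y \<le> d"
    using Y(2) by (intro LIMSEQ_le[of "\<lambda>n. q (Y n)"]) (auto intro: less_imp_le)
  have "ip (x - y) u = 0" if u: "u \<in> G" for u
  proof -
    \<comment> \<open>Minimality of \<open>y\<close> makes a quadratic polynomial with constant term
      0 nonnegative, so its linear coefficient vanishes.\<close>
    have "(- ip (x - y) u)\<^sup>2 \<le> 0 * ip u u"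
    proof (rule quadratic_nonneg_discriminant)
      fix t
      have "q y \<le> q (y + t *\<^sub>R u)"
        using qy d_le[of "y + t *\<^sub>R u"] G y u by (force intro: subspace_add subspace_scale)
      also have "q (y + t *\<^sub>R u) = q y + 2 * t * (- ip (x - y) u) + t\<^sup>2 * ip u u"
        using x GH[OF y(1)] GH[OF u] unfolding q_def
        by (simp add: ip_simps ip_commute[of u x] ip_commute[of u y] ip_commute[of y x] power2_eq_square algebra_simps)
      finally show "0 \<le> 0 + 2 * t * (- ip (x - y) u) + t\<^sup>2 * ip u u" by simp
    qed
    then show ?thesis by simp
  qed
  with y(1) show ?thesis by blast
qed

end

text \<open>Flows live on the half-line, where the derivative at 0 is one-sided. A derivative within
  \<open>S\<close> restricts to one within the interval, and the mean value theorem applies.\<close>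

lemma antimono_of_deriv_within:
  fixes q :: "real \<Rightarrow> real"
  assumes "a \<le> b"
    and "\<And>x. \<lbrakk>a \<le> x; x \<le> b\<rbrakk> \<Longrightarrow> (q has_real_derivative q' x) (at x within S)"
    and "\<And>x. \<lbrakk>a \<le> x; x \<le> b\<rbrakk> \<Longrightarrow> q' x \<le> 0"
    and "{a..b} \<subseteq> S"
  shows "q b \<le> q a"
proof (cases "a = b")
  case False
  with assms(1) have ab: "a < b" by simp
  have "\<exists>x\<in>{a<..<b}. q b - q a = q' x * (b - a)"
  proof (rule mvt_simple[OF ab])
    fix x assume "a \<le> x" "x \<le> b"
    then show "(q has_derivative (*) (q' x)) (at x within {a..b})"
      using has_field_derivative_subset[OF assms(2) assms(4)] by (auto simp: has_field_derivative_def)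
  qed
  then obtain x where x: "a < x" "x < b" "q b - q a = q' x * (b - a)" by auto
  then have "q' x * (b - a) \<le> 0" using assms(3)[of x] ab by (intro mult_nonpos_nonneg) auto
  with x show ?thesis by simp
qed simp

section \<open>Curves differentiable in the seminorm\<close>

context semi_inner
begin

definition has_der :: "(real \<Rightarrow> 'v) \<Rightarrow> 'v \<Rightarrow> real \<Rightarrow> bool" where
  "has_der g g' t \<longleftrightarrow> (\<forall>s\<ge>0. g s \<in> H) \<and> conv (\<lambda>s. (1 / (s - t)) *\<^sub>R (g s - g t)) g' (at t within {0..})"

lemma eventually_within_ge: "\<forall>\<^sub>F s in at t within {0..}. (0::real) \<le> s"
  by (auto simp: eventually_at_filter)

lemma has_der_const: "x \<in> H \<Longrightarrow> has_der (\<lambda>_. x) 0 t"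
  by (simp add: has_der_def conv_def)

lemma has_der_diff:
  assumes "has_der f f' t" "has_der g g' t"
  shows "has_der (\<lambda>s. f s - g s) (f' - g') t"
proof -
  have eq: "(1 / (s - t)) *\<^sub>R (f s - g s - (f t - g t)) =
      (1 / (s - t)) *\<^sub>R (f s - f t) - (1 / (s - t)) *\<^sub>R (g s - g t)" for s
  proof -
    have "f s - g s - (f t - g t) = f s - f t - (g s - g t)" by (simp add: algebra_simps)
    then show ?thesis by (simp only: scaleR_diff_right)
  qed
  show ?thesis
    using assms unfolding has_der_def eq by (auto intro: conv_diff)
qed

lemma has_der_cong:
  assumes "has_der f f' t" "t \<ge> 0" "\<And>s. s \<ge> 0 \<Longrightarrow> g s \<in> H" "\<And>s. s \<ge> 0 \<Longrightarrow> f s \<doteq> g s"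
    "g' \<in> H" "f' \<doteq> g'"
  shows "has_der g g' t"
  unfolding has_der_def
proof (rule conjI[rotated], rule conv_eqv)
  show "conv (\<lambda>s. (1 / (s - t)) *\<^sub>R (f s - f t)) f' (at t within {0..})"
    using assms by (simp add: has_der_def)
  have f: "\<And>s. s \<ge> 0 \<Longrightarrow> f s \<in> H" using assms(1) by (simp add: has_der_def)
  show "\<forall>\<^sub>F s in at t within {0..}. (1 / (s - t)) *\<^sub>R (g s - g t) \<in> H \<and>
      (1 / (s - t)) *\<^sub>R (g s - g t) \<doteq> (1 / (s - t)) *\<^sub>R (f s - f t)"
    using eventually_within_ge
  proof eventually_elim
    fix s :: real assume s: "0 \<le> s"
    have "g s \<doteq> f s" "g t \<doteq> f t"
      using s assms(2-4) f by (auto intro!: eqv_sym[of "f _"])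
    then show "(1 / (s - t)) *\<^sub>R (g s - g t) \<in> H \<and>
        (1 / (s - t)) *\<^sub>R (g s - g t) \<doteq> (1 / (s - t)) *\<^sub>R (f s - f t)"
      using s assms(2,3) f by (auto intro!: eqv_scale eqv_diff)
  qed
qed (use assms in auto)

lemma has_der_conv:
  assumes "has_der g g' t" "t \<ge> 0"
  shows "conv g (g t) (at t within {0..})"
proof -
  have g: "\<And>s. s \<ge> 0 \<Longrightarrow> g s \<in> H" using assms by (simp add: has_der_def)
  have "((\<lambda>s. s - t) \<longlongrightarrow> t - t) (at t within {0..})" by (intro tendsto_intros)
  then have "conv (\<lambda>s. g t + (s - t) *\<^sub>R ((1 / (s - t)) *\<^sub>R (g s - g t))) (g t + 0 *\<^sub>R g')
      (at t within {0..})"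
    using assms g by (intro conv_add conv_scale conv_const) (auto simp: has_der_def)
  then show ?thesis
  proof (rule conv_eqv)
    show "\<forall>\<^sub>F s in at t within {0..}. g s \<in> H \<and>
      g s \<doteq> g t + (s - t) *\<^sub>R ((1 / (s - t)) *\<^sub>R (g s - g t))"
      using g by (auto simp: eventually_at_filter)
  qed (use g assms in auto)
qed

lemma has_der_ip:
  assumes "has_der f f' t" "has_der g g' t" "t \<ge> 0"
  shows "((\<lambda>s. ip (f s) (g s)) has_real_derivative ip f' (g t) + ip (f t) g') (at t within {0..})"
  unfolding has_field_derivative_iff
proof (rule Lim_transform_eventually)
  have H: "\<And>s. s \<ge> 0 \<Longrightarrow> f s \<in> H" "\<And>s. s \<ge> 0 \<Longrightarrow> g s \<in> H" using assms by (auto simp: has_der_def)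
  show "((\<lambda>s. ip ((1 / (s - t)) *\<^sub>R (f s - f t)) (g s) + ip (f t) ((1 / (s - t)) *\<^sub>R (g s - g t)))
      \<longlongrightarrow> ip f' (g t) + ip (f t) g') (at t within {0..})"
    using assms H by (intro tendsto_add conv_ip conv_const has_der_conv) (auto simp: has_der_def)
  show "\<forall>\<^sub>F s in at t within {0..}.
      ip ((1 / (s - t)) *\<^sub>R (f s - f t)) (g s) + ip (f t) ((1 / (s - t)) *\<^sub>R (g s - g t)) =
      (ip (f s) (g s) - ip (f t) (g t)) / (s - t)"
    using eventually_within_ge
  proof eventually_elim
    fix s :: real assume s: "0 \<le> s"
    have "ip ((1 / (s - t)) *\<^sub>R (f s - f t)) (g s) + ip (f t) ((1 / (s - t)) *\<^sub>R (g s - g t)) =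
        1 / (s - t) * (ip (f s) (g s) - ip (f t) (g s)) + 1 / (s - t) * (ip (f t) (g s) - ip (f t) (g t))"
      using s assms(3) H by (simp add: ip_simps)
    also have "\<dots> = 1 / (s - t) * (ip (f s) (g s) - ip (f t) (g t))"
      by (simp only: flip: distrib_left) simp
    finally show "ip ((1 / (s - t)) *\<^sub>R (f s - f t)) (g s) +
        ip (f t) ((1 / (s - t)) *\<^sub>R (g s - g t)) = (ip (f s) (g s) - ip (f t) (g t)) / (s - t)"
      by simp
  qed
qed

text \<open>Energy method: the squared seminorm of \<open>w\<close> has derivative
  \<open>2 * ip (w' t) (w t)\<close>, so it does not increase from its initial value 0. This yields
  uniqueness for the Cauchy problem.\<close>

lemma dissipative_flow_zero:
  assumes "\<And>t. t \<ge> 0 \<Longrightarrow> has_der w (w' t) t" "\<And>t. t \<ge> 0 \<Longrightarrow> ip (w' t) (w t) \<le> 0"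
    and "w 0 \<doteq> 0" "t \<ge> 0"
  shows "w t \<doteq> 0"
proof -
  have w: "w s \<in> H" "w' s \<in> H" if "s \<ge> 0" for s
    using assms(1)[of 0] assms(1)[OF that] that by (auto simp: has_der_def conv_def)
  have "ip (w t) (w t) \<le> ip (w 0) (w 0)"
  proof (rule antimono_of_deriv_within[where S = "{0..}" and a = 0 and b = t and
        q = "\<lambda>s. ip (w s) (w s)" and q' = "\<lambda>s. 2 * ip (w' s) (w s)"])
    fix x :: real assume "0 \<le> x" "x \<le> t"
    then show "((\<lambda>s. ip (w s) (w s)) has_real_derivative 2 * ip (w' x) (w x)) (at x within {0..})"
      using has_der_ip[OF assms(1) assms(1), of x] w[of x] by (simp add: ip_commute)
  qed (use assms in auto)
  also have "ip (w 0) (w 0) = 0" using assms(3) w(1)[of 0] nrm_sq[of "w 0"] by (simp add: eqv_zero_iff)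
  finally show ?thesis using ip_ge_0[OF w(1)[OF assms(4)]] w(1)[OF assms(4)] by (intro eqv_ip_zero) auto
qed

end

section \<open>Contraction semigroups and normal generators\<close>

text \<open>The laws are stated with \<open>\<doteq>\<close> because the extension to L^2 returns an
  arbitrary member of an a.e. class: even \<open>S t (x + y)\<close> and
  \<open>S t x + S t y\<close> may differ on a null set.\<close>

locale contraction_semigroup = semi_inner H ip
  for H :: "'v::real_vector set" and ip :: "'v \<Rightarrow> 'v \<Rightarrow> real" +
  fixes S :: "real \<Rightarrow> 'v \<Rightarrow> 'v"
  assumes S_H [simp, intro]: "\<lbrakk>t \<ge> 0; x \<in> H\<rbrakk> \<Longrightarrow> S t x \<in> H"
    and S_add: "\<lbrakk>t \<ge> 0; x \<in> H; y \<in> H\<rbrakk> \<Longrightarrow> S t (x + y) \<doteq> S t x + S t y"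
    and S_scale: "\<lbrakk>t \<ge> 0; x \<in> H\<rbrakk> \<Longrightarrow> S t (a *\<^sub>R x) \<doteq> a *\<^sub>R S t x"
    and S_contraction: "\<lbrakk>t \<ge> 0; x \<in> H\<rbrakk> \<Longrightarrow> nrm (S t x) \<le> nrm x"
    and S_plus: "\<lbrakk>s \<ge> 0; t \<ge> 0; x \<in> H\<rbrakk> \<Longrightarrow> S (s + t) x \<doteq> S s (S t x)"
    and S_zero: "x \<in> H \<Longrightarrow> S 0 x \<doteq> x"
    and S_conv: "x \<in> H \<Longrightarrow> conv (\<lambda>t. S t x) x (at_right 0)"
begin

lemma S_diff: assumes "t \<ge> 0" "x \<in> H" "y \<in> H" shows "S t (x - y) \<doteq> S t x - S t y"
proof -
  have "S t (x + (-1) *\<^sub>R y) \<doteq> S t x + S t ((-1) *\<^sub>R y)" using assms by (intro S_add) auto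
  moreover have "S t x + S t ((-1) *\<^sub>R y) \<doteq> S t x + (-1) *\<^sub>R S t y"
    using assms by (intro eqv_add S_scale) auto
  ultimately have "S t (x + (-1) *\<^sub>R y) \<doteq> S t x + (-1) *\<^sub>R S t y"
    by (rule eqv_trans[rotated -2]) (use assms in auto)
  then show ?thesis by simp
qed

lemma S_lipschitz: "\<lbrakk>t \<ge> 0; x \<in> H; y \<in> H\<rbrakk> \<Longrightarrow> nrm (S t x - S t y) \<le> nrm (x - y)"
  using S_contraction[of t "x - y"] nrm_cong[OF _ _ S_diff, of t x y] by simp

lemma S_cong: "\<lbrakk>t \<ge> 0; x \<in> H; y \<in> H; x \<doteq> y\<rbrakk> \<Longrightarrow> S t x \<doteq> S t y"
  using S_lipschitz[of t x y] nrm_ge_0[of "S t x - S t y"] by (auto simp: eqv_def simp del: nrm_ge_0)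

text \<open>The generator is kept as a graph: its values are determined only modulo null vectors,
  and closedness and the later projection are statements about the graph.\<close>

definition gen :: "'v \<Rightarrow> 'v \<Rightarrow> bool" where
  "gen f h \<longleftrightarrow> f \<in> H \<and> conv (\<lambda>t. (1 / t) *\<^sub>R (S t f - f)) h (at_right 0)"

lemma gen_H: "gen f h \<Longrightarrow> f \<in> H" "gen f h \<Longrightarrow> h \<in> H"
  by (auto simp: gen_def conv_def)

lemma gen_unique: "\<lbrakk>gen f h; gen f h'\<rbrakk> \<Longrightarrow> h \<doteq> h'"
  unfolding gen_def by (elim conjE, rule conv_unique[of "at_right (0::real)"]) auto

lemma eventually_gt_0: "\<forall>\<^sub>F t in at_right 0. (0::real) < t"
  by (simp add: eventually_at_right_less)

lemma gen_cong:
  assumes "gen f h" "f' \<in> H" "h' \<in> H" "f \<doteq> f'" "h \<doteq> h'"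
  shows "gen f' h'"
  unfolding gen_def
proof (rule conjI[rotated], rule conv_eqv)
  show "conv (\<lambda>t. (1 / t) *\<^sub>R (S t f - f)) h (at_right 0)" using assms by (simp add: gen_def)
  have f: "f \<in> H" using assms by (simp add: gen_H)
  show "\<forall>\<^sub>F t in at_right 0. (1 / t) *\<^sub>R (S t f' - f') \<in> H \<and>
      (1 / t) *\<^sub>R (S t f' - f') \<doteq> (1 / t) *\<^sub>R (S t f - f)"
    using eventually_gt_0
    by eventually_elim
      (use eqv_sym[OF f assms(2,4)] assms(2) f in \<open>auto intro!: eqv_scale eqv_diff S_cong\<close>)
qed (use assms in auto)

lemma gen_add:
  assumes "gen f h" "gen f' h'"
  shows "gen (f + f') (h + h')"
  unfolding gen_def
proof (rule conjI[rotated], rule conv_eqv)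
  have H: "f \<in> H" "f' \<in> H" "h \<in> H" "h' \<in> H" using assms by (auto simp: gen_H)
  then show "f + f' \<in> H" "h + h' \<in> H" by auto
  show "conv (\<lambda>t. (1 / t) *\<^sub>R (S t f - f) + (1 / t) *\<^sub>R (S t f' - f')) (h + h') (at_right 0)"
    using assms by (intro conv_add) (auto simp: gen_def)
  show "\<forall>\<^sub>F t in at_right 0. (1 / t) *\<^sub>R (S t (f + f') - (f + f')) \<in> H \<and>
      (1 / t) *\<^sub>R (S t (f + f') - (f + f')) \<doteq> (1 / t) *\<^sub>R (S t f - f) + (1 / t) *\<^sub>R (S t f' - f')"
    using eventually_gt_0
  proof eventually_elim
    fix t :: real assume t: "0 < t"
    have "(1 / t) *\<^sub>R (S t (f + f') - (f + f')) \<doteq> (1 / t) *\<^sub>R (S t f + S t f' - (f + f'))"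
      using t H by (intro eqv_scale eqv_diff S_add) auto
    then show "(1 / t) *\<^sub>R (S t (f + f') - (f + f')) \<in> H \<and>
      (1 / t) *\<^sub>R (S t (f + f') - (f + f')) \<doteq> (1 / t) *\<^sub>R (S t f - f) + (1 / t) *\<^sub>R (S t f' - f')"
      using t H by (simp add: add_diff_add scaleR_add_right)
  qed
qed auto

lemma gen_scale:
  assumes "gen f h"
  shows "gen (a *\<^sub>R f) (a *\<^sub>R h)"
  unfolding gen_def
proof (rule conjI[rotated], rule conv_eqv)
  have H: "f \<in> H" "h \<in> H" using assms by (auto simp: gen_H)
  then show "a *\<^sub>R f \<in> H" "a *\<^sub>R h \<in> H" by auto
  show "conv (\<lambda>t. a *\<^sub>R ((1 / t) *\<^sub>R (S t f - f))) (a *\<^sub>R h) (at_right 0)"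
    using assms by (intro conv_scale) (auto simp: gen_def)
  show "\<forall>\<^sub>F t in at_right 0. (1 / t) *\<^sub>R (S t (a *\<^sub>R f) - a *\<^sub>R f) \<in> H \<and>
      (1 / t) *\<^sub>R (S t (a *\<^sub>R f) - a *\<^sub>R f) \<doteq> a *\<^sub>R ((1 / t) *\<^sub>R (S t f - f))"
    using eventually_gt_0
  proof eventually_elim
    fix t :: real assume t: "0 < t"
    have "(1 / t) *\<^sub>R (S t (a *\<^sub>R f) - a *\<^sub>R f) \<doteq> (1 / t) *\<^sub>R (a *\<^sub>R S t f - a *\<^sub>R f)"
      using t H by (intro eqv_scale eqv_diff S_scale) auto
    then show "(1 / t) *\<^sub>R (S t (a *\<^sub>R f) - a *\<^sub>R f) \<in> H \<and>
      (1 / t) *\<^sub>R (S t (a *\<^sub>R f) - a *\<^sub>R f) \<doteq> a *\<^sub>R ((1 / t) *\<^sub>R (S t f - f))"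
      using t H by (simp add: scaleR_diff_right mult.commute)
  qed
qed auto

text \<open>Contractivity and Cauchy-Schwarz bound \<open>ip (S t f) f\<close> by
  \<open>ip f f\<close>, so the difference quotients already have the right sign.\<close>

lemma gen_dissipative:
  assumes "gen f h"
  shows "ip h f \<le> 0"
proof (rule tendsto_upperbound)
  have H: "f \<in> H" "h \<in> H" using assms by (auto simp: gen_H)
  show "((\<lambda>t. ip ((1 / t) *\<^sub>R (S t f - f)) f) \<longlongrightarrow> ip h f) (at_right 0)"
    using assms by (intro conv_ip conv_const) (auto simp: gen_def)
  show "\<forall>\<^sub>F t in at_right 0. ip ((1 / t) *\<^sub>R (S t f - f)) f \<le> 0"
    using eventually_gt_0
  proof eventually_elim
    fix t :: real assume t: "0 < t"
    have "ip (S t f) f \<le> nrm (S t f) * nrm f" using Cauchy_Schwarz[of "S t f" f] t H by auto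
    also have "\<dots> \<le> nrm f * nrm f" using S_contraction[of t f] t H by (intro mult_right_mono) auto
    also have "\<dots> = ip f f" using nrm_sq[OF H(1)] by (simp add: power2_eq_square)
    finally show "ip ((1 / t) *\<^sub>R (S t f - f)) f \<le> 0"
      using t H by (simp add: ip_simps divide_nonpos_pos)
  qed
qed simp

lemma S_quotient:
  assumes "s \<ge> 0" "t \<ge> 0" "f \<in> H"
  shows "a *\<^sub>R (S (s + t) f - S s f) \<doteq> S s (a *\<^sub>R (S t f - f))"
proof -
  have *: "a *\<^sub>R (S (s + t) f - S s f) \<doteq> a *\<^sub>R (S s (S t f) - S s f)"
    using assms by (intro eqv_scale eqv_diff S_plus) auto
  have "a *\<^sub>R (S s (S t f) - S s f) \<doteq> a *\<^sub>R S s (S t f - f)"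
    using assms by (intro eqv_scale eqv_sym[OF _ _ S_diff]) auto
  moreover have "a *\<^sub>R S s (S t f - f) \<doteq> S s (a *\<^sub>R (S t f - f))"
    using assms by (intro eqv_sym[OF _ _ S_scale]) auto
  ultimately have "a *\<^sub>R (S s (S t f) - S s f) \<doteq> S s (a *\<^sub>R (S t f - f))"
    by (rule eqv_trans[rotated -2]) (use assms in auto)
  with * show ?thesis by (rule eqv_trans[rotated -2]) (use assms in auto)
qed

lemma gen_S:
  assumes "gen f h" "t \<ge> 0"
  shows "gen (S t f) (S t h)"
  unfolding gen_def
proof (intro conjI convI)
  have H: "f \<in> H" "h \<in> H" using assms by (auto simp: gen_H)
  then show "S t f \<in> H" "S t h \<in> H" using assms by auto
  show "((\<lambda>s. nrm ((1 / s) *\<^sub>R (S s f - f) - h)) \<longlongrightarrow> 0) (at_right 0)"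
    using assms by (auto simp: gen_def conv_def)
  show "\<forall>\<^sub>F s in at_right 0. nrm ((1 / s) *\<^sub>R (S s (S t f) - S t f) - S t h)
      \<le> nrm ((1 / s) *\<^sub>R (S s f - f) - h)"
    using eventually_gt_0
  proof eventually_elim
    fix s :: real assume s: "0 < s"
    have "S s (S t f) \<doteq> S (s + t) f" using s assms H by (intro eqv_sym[OF _ _ S_plus]) auto
    then have "(1 / s) *\<^sub>R (S s (S t f) - S t f) \<doteq> (1 / s) *\<^sub>R (S (t + s) f - S t f)"
      using s assms H by (intro eqv_scale eqv_diff) (auto simp: add.commute)
    moreover have "(1 / s) *\<^sub>R (S (t + s) f - S t f) \<doteq> S t ((1 / s) *\<^sub>R (S s f - f))"
      using s assms H by (intro S_quotient) auto
    ultimately have "(1 / s) *\<^sub>R (S s (S t f) - S t f) \<doteq> S t ((1 / s) *\<^sub>R (S s f - f))"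
      by (rule eqv_trans[rotated -2]) (use s H assms in auto)
    then have "(1 / s) *\<^sub>R (S s (S t f) - S t f) - S t h \<doteq> S t ((1 / s) *\<^sub>R (S s f - f)) - S t h"
      using s H assms by (intro eqv_diff) auto
    then have "nrm ((1 / s) *\<^sub>R (S s (S t f) - S t f) - S t h) =
        nrm (S t ((1 / s) *\<^sub>R (S s f - f)) - S t h)"
      using s H assms by (intro nrm_cong) auto
    also have "\<dots> \<le> nrm ((1 / s) *\<^sub>R (S s f - f) - h)" using s H assms by (intro S_lipschitz) auto
    finally show "nrm ((1 / s) *\<^sub>R (S s (S t f) - S t f) - S t h) \<le> nrm ((1 / s) *\<^sub>R (S s f - f) - h)" .
  qed
  show "\<forall>\<^sub>F s in at_right 0. (1 / s) *\<^sub>R (S s (S t f) - S t f) \<in> H"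
    using eventually_gt_0 by eventually_elim (use H assms in auto)
qed

text \<open>\<open>gen\<close> only gives the right derivative at 0. Quotients from the right at
  \<open>t\<close> are images under \<open>S t\<close> of quotients at 0. From the left, with
  \<open>d = t - s\<close>, the quotient is an image under \<open>S s\<close>, and the target must
  be written as \<open>S s (S d h)\<close>; this adds the error \<open>nrm (S d h - h)\<close>, the
  second term of \<open>r\<close>, which strong continuity makes small.\<close>

lemma S_has_der:
  assumes "gen f h" "t \<ge> 0"
  shows "has_der (\<lambda>s. S s f) (S t h) t"
  unfolding has_der_def
proof (intro conjI convI allI impI)
  have H: "f \<in> H" "h \<in> H" using assms by (auto simp: gen_H)
  then show "S t h \<in> H" "\<And>s. s \<ge> 0 \<Longrightarrow> S s f \<in> H" using assms by auto
  define r where "r s = nrm ((1 / s) *\<^sub>R (S s f - f) - h) + nrm (S s h - h)" for s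
  have "(r \<longlongrightarrow> 0 + 0) (at_right 0)"
    unfolding r_def using assms S_conv[OF H(2)]
    by (intro tendsto_add) (auto simp: gen_def conv_def)
  moreover have "filterlim (\<lambda>s. \<bar>s - t\<bar>) (at_right 0) (at t within {0..})"
    unfolding filterlim_at
  proof
    have "((\<lambda>s. \<bar>s - t\<bar>) \<longlongrightarrow> \<bar>t - t\<bar>) (at t within {0..})" by (intro tendsto_intros)
    then show "((\<lambda>s. \<bar>s - t\<bar>) \<longlongrightarrow> 0) (at t within {0..})" by simp
  qed (auto simp: eventually_at_filter)
  ultimately show "((\<lambda>s. r \<bar>s - t\<bar>) \<longlongrightarrow> 0) (at t within {0..})"
    using filterlim_compose by fastforce
  show "\<forall>\<^sub>F s in at t within {0..}. (1 / (s - t)) *\<^sub>R (S s f - S t f) \<in> H"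
    using eventually_within_ge by eventually_elim (use H assms in auto)
  have "nrm ((1 / (s - t)) *\<^sub>R (S s f - S t f) - S t h) \<le> r \<bar>s - t\<bar>" if s: "s \<ge> 0" "s \<noteq> t" for s
  proof (cases "s > t")
    case True
    have "(1 / (s - t)) *\<^sub>R (S s f - S t f) \<doteq> S t ((1 / (s - t)) *\<^sub>R (S (s - t) f - f))"
      using S_quotient[of t "s - t" f "1 / (s - t)"] True assms H by simp
    then have "(1 / (s - t)) *\<^sub>R (S s f - S t f) - S t h \<doteq> S t ((1 / (s - t)) *\<^sub>R (S (s - t) f - f)) - S t h"
      using True s H assms by (intro eqv_diff) auto
    then have "nrm ((1 / (s - t)) *\<^sub>R (S s f - S t f) - S t h) =
        nrm (S t ((1 / (s - t)) *\<^sub>R (S (s - t) f - f)) - S t h)"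
      using True s H assms by (intro nrm_cong) auto
    also have "\<dots> \<le> nrm ((1 / (s - t)) *\<^sub>R (S (s - t) f - f) - h)"
      using True s H assms by (intro S_lipschitz) auto
    also have "\<dots> \<le> r \<bar>s - t\<bar>" using True H by (simp add: r_def)
    finally show ?thesis .
  next
    case False
    define d where "d = t - s"
    have d: "d > 0" "t = s + d" "\<bar>s - t\<bar> = d" using False s by (auto simp: d_def)
    have "(1 / (s - t)) *\<^sub>R (S s f - S t f) = (1 / d) *\<^sub>R (S (s + d) f - S s f)"
      using d by (simp add: scaleR_diff_right)
    also have "\<dots> \<doteq> S s ((1 / d) *\<^sub>R (S d f - f))"
      using d s H by (intro S_quotient) auto
    finally have "(1 / (s - t)) *\<^sub>R (S s f - S t f) \<doteq> S s ((1 / d) *\<^sub>R (S d f - f))" .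
    moreover have "S t h \<doteq> S s (S d h)" using d s H by (auto intro!: S_plus)
    ultimately have "nrm ((1 / (s - t)) *\<^sub>R (S s f - S t f) - S t h) =
        nrm (S s ((1 / d) *\<^sub>R (S d f - f)) - S s (S d h))"
      using s d H by (intro nrm_cong eqv_diff) auto
    also have "\<dots> \<le> nrm ((1 / d) *\<^sub>R (S d f - f) - S d h)"
      using s d H by (intro S_lipschitz) auto
    also have "\<dots> \<le> nrm ((1 / d) *\<^sub>R (S d f - f) - h) + nrm (h - S d h)"
      using s d H by (intro nrm_triangle_diff) auto
    also have "\<dots> = r \<bar>s - t\<bar>" using d H by (simp add: r_def nrm_diff_commute)
    finally show ?thesis .
  qed
  then show "\<forall>\<^sub>F s in at t within {0..}. nrm ((1 / (s - t)) *\<^sub>R (S s f - S t f) - S t h) \<le> r \<bar>s - t\<bar>"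
    by (auto simp: eventually_at_filter)
qed

text \<open>A mean value inequality that takes the place of writing \<open>S t f - f\<close> as the
  integral of \<open>S s h\<close>. The vector-valued statement becomes a scalar one by testing
  against the residual \<open>z\<close> itself.\<close>

lemma gen_quotient_bound:
  assumes "gen f h" "t > 0" "\<And>s. \<lbrakk>0 \<le> s; s \<le> t\<rbrakk> \<Longrightarrow> nrm (S s h - h) \<le> M"
  shows "nrm ((1 / t) *\<^sub>R (S t f - f) - h) \<le> M"
proof -
  have H: "f \<in> H" "h \<in> H" using assms by (auto simp: gen_H)
  define z where "z = S t f - f - t *\<^sub>R h"
  have z: "z \<in> H" using H assms by (simp add: z_def)
  have M: "0 \<le> M" using order_trans[OF nrm_ge_0[of "S 0 h - h"] assms(3)[of 0]] assms(2) H by simp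
  \<comment> \<open>The derivative of \<open>q\<close> is
    \<open>ip (S s h - h) z - M * nrm z\<close>, nonpositive by Cauchy-Schwarz. Comparing the
    endpoints gives \<open>ip z z \<le> t * M * nrm z\<close>, and one factor \<open>nrm z\<close>
    cancels.\<close>
  define q where "q s = ip (S s f) z - s * (ip h z + M * nrm z)" for s
  have "q t \<le> q 0"
  proof (rule antimono_of_deriv_within[where S = "{0..}" and q = q and a = 0 and b = t and
        q' = "\<lambda>s. ip (S s h) z - (ip h z + M * nrm z)"])
    fix s assume s: "0 \<le> s" "s \<le> t"
    have "((\<lambda>s. ip (S s f) z) has_real_derivative ip (S s h) z) (at s within {0..})"
      using has_der_ip[OF S_has_der[OF assms(1) s(1)] has_der_const[OF z] s(1)] s H
      by (simp add: ip_zero_right)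
    then show "(q has_real_derivative ip (S s h) z - (ip h z + M * nrm z)) (at s within {0..})"
      unfolding q_def by (auto intro!: derivative_eq_intros)
    have "ip (S s h - h) z \<le> nrm (S s h - h) * nrm z" using Cauchy_Schwarz[of "S s h - h" z] s z H by auto
    also have "\<dots> \<le> M * nrm z" using assms(3)[OF s] z by (intro mult_right_mono) auto
    finally show "ip (S s h) z - (ip h z + M * nrm z) \<le> 0" using s z H by (simp add: ip_simps)
  qed (use assms in auto)
  then have "ip (S t f) z - ip (S 0 f) z - t * ip h z \<le> t * M * nrm z"
    by (simp add: q_def algebra_simps)
  moreover have "ip (S 0 f) z = ip f z" using S_zero H z by (intro ip_cong_left) auto
  moreover have "ip (S t f - f - t *\<^sub>R h) z = ip (S t f) z - ip f z - t * ip h z"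
    using z H assms(2) by (simp add: ip_simps)
  ultimately have "ip z z \<le> t * M * nrm z"
    by (simp flip: z_def)
  then have "nrm z * nrm z \<le> t * M * nrm z" using nrm_sq[OF z] by (simp add: power2_eq_square)
  then have "nrm z \<le> t * M"
    using nrm_ge_0[OF z] M assms(2) by (cases "nrm z = 0") (auto simp: mult_le_cancel_right)
  moreover have "(1 / t) *\<^sub>R (S t f - f) - h = (1 / t) *\<^sub>R z"
    using assms(2) by (simp add: z_def scaleR_diff_right)
  ultimately show ?thesis using assms(2) z by (simp add: nrm_scale field_simps)
qed

text \<open>Two limits in a fixed order: for fixed \<open>t\<close> the quotient bound passes from
  the pairs \<open>(X n, Y n)\<close> to \<open>(x, y)\<close>, and only afterwards \<open>t\<close>
  tends to 0, using strong continuity at \<open>y\<close>. The term \<open>2 * nrm (Y n - y)\<close>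
  pays for replacing \<open>Y n\<close> by \<open>y\<close> twice, once under the contraction
  \<open>S s\<close>.\<close>

lemma gen_closed:
  assumes gen: "\<And>n. gen (X n) (Y n)" and X: "conv X x sequentially" and Y: "conv Y y sequentially"
  shows "gen x y"
proof -
  have H: "x \<in> H" "y \<in> H" "\<And>n. X n \<in> H" "\<And>n. Y n \<in> H"
    using X Y gen_H[OF gen] by (auto simp: conv_def)
  have bound: "nrm ((1 / t) *\<^sub>R (S t x - x) - y) \<le> e"
    if t: "0 < t" and e: "\<And>s. \<lbrakk>0 \<le> s; s \<le> t\<rbrakk> \<Longrightarrow> nrm (S s y - y) \<le> e" for t e
  proof (rule LIMSEQ_le)
    have SX: "conv (\<lambda>n. S t (X n)) (S t x) sequentially"
    proof (rule convI)
      show "\<forall>\<^sub>F n in sequentially. nrm (S t (X n) - S t x) \<le> nrm (X n - x)"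
        using t H by (intro always_eventually allI S_lipschitz) auto
    qed (use X H t in \<open>auto simp: conv_def\<close>)
    show "(\<lambda>n. nrm ((1 / t) *\<^sub>R (S t (X n) - X n) - Y n)) \<longlonglongrightarrow> nrm ((1 / t) *\<^sub>R (S t x - x) - y)"
      by (intro conv_nrm conv_diff conv_scale SX X Y tendsto_const)
    have "(\<lambda>n. 2 * nrm (Y n - y) + e) \<longlonglongrightarrow> 2 * 0 + e"
      using Y by (intro tendsto_intros) (auto simp: conv_def)
    then show "(\<lambda>n. 2 * nrm (Y n - y) + e) \<longlonglongrightarrow> e" by simp
    have "nrm ((1 / t) *\<^sub>R (S t (X n) - X n) - Y n) \<le> 2 * nrm (Y n - y) + e" for n
    proof (rule gen_quotient_bound[OF gen t])
      fix s assume s: "0 \<le> s" "s \<le> t"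
      have "nrm (S s (Y n) - Y n) \<le> nrm (S s (Y n) - S s y) + nrm (S s y - Y n)"
        using s H by (intro nrm_triangle_diff) auto
      also have "\<dots> \<le> nrm (Y n - y) + (nrm (S s y - y) + nrm (y - Y n))"
        using s H by (intro add_mono S_lipschitz nrm_triangle_diff) auto
      also have "\<dots> \<le> 2 * nrm (Y n - y) + e" using e[OF s] H by (simp add: nrm_diff_commute)
      finally show "nrm (S s (Y n) - Y n) \<le> 2 * nrm (Y n - y) + e" .
    qed
    then show "\<exists>N. \<forall>n\<ge>N. nrm ((1 / t) *\<^sub>R (S t (X n) - X n) - Y n) \<le> 2 * nrm (Y n - y) + e" by blast
  qed
  have "((\<lambda>t. nrm ((1 / t) *\<^sub>R (S t x - x) - y)) \<longlongrightarrow> 0) (at_right 0)"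
  proof (rule tendstoI)
    fix e :: real assume e: "e > 0"
    have "((\<lambda>s. nrm (S s y - y)) \<longlongrightarrow> 0) (at_right 0)" using S_conv[OF H(2)] by (simp add: conv_def)
    then have "\<forall>\<^sub>F s in at_right 0. nrm (S s y - y) < e / 2" using e by (intro order_tendstoD(2)[of _ 0]) auto
    then obtain b where b: "b > 0" "\<And>s. \<lbrakk>0 < s; s < b\<rbrakk> \<Longrightarrow> nrm (S s y - y) < e / 2"
      by (auto simp: eventually_at_right_field)
    \<comment> \<open>The filter \<open>at_right 0\<close> says nothing about \<open>s = 0\<close>,
      which the closed interval in \<open>bound\<close> contains.\<close>
    have "nrm (S 0 y - y) = 0" using S_zero[OF H(2)] by (simp add: eqv_def)
    then have b': "nrm (S s y - y) \<le> e / 2" if "0 \<le> s" "s < b" for s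
      using that e b(2)[of s] by (cases "s = 0") auto
    have "\<forall>\<^sub>F t in at_right 0. 0 < t \<and> t < b"
      using b(1) by (auto simp: eventually_at_right_field)
    then show "\<forall>\<^sub>F t in at_right 0. dist (nrm ((1 / t) *\<^sub>R (S t x - x) - y)) 0 < e"
    proof eventually_elim
      fix t assume t: "0 < t \<and> t < b"
      then have "nrm ((1 / t) *\<^sub>R (S t x - x) - y) \<le> e / 2" by (intro bound b') auto
      moreover have "0 \<le> nrm ((1 / t) *\<^sub>R (S t x - x) - y)" using t H by (intro nrm_ge_0) auto
      ultimately show "dist (nrm ((1 / t) *\<^sub>R (S t x - x) - y)) 0 < e" using e by simp
    qed
  qed
  moreover have "\<forall>\<^sub>F t in at_right 0. (1 / t) *\<^sub>R (S t x - x) \<in> H"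
    using eventually_gt_0 by eventually_elim (use H in auto)
  ultimately show ?thesis using H by (simp add: gen_def conv_def)
qed

end

section \<open>Product spaces and normal generators\<close>

lemma semi_inner_Times:
  assumes "semi_inner H ip"
  shows "semi_inner (H \<times> H) (\<lambda>p q. ip (fst p) (fst q) + ip (snd p) (snd q))"
proof -
  interpret semi_inner H ip by fact
  show ?thesis
  proof
    show "subspace (H \<times> H)" by (intro subspace_Times subspace_H)
  qed (auto simp: ip_add_left ip_scale_left ip_ge_0 distrib_left, metis ip_commute)
qed

text \<open>\<open>D_adj_iff\<close> carries the equality of domains in normality: possessing an
  adjoint value is enough to lie in \<open>D\<close>. The vector \<open>one\<close> stands for the
  constant function 1; \<open>S_one\<close> reflects the Markov property and \<open>ip_S_one\<close>
  the stationarity of the measure.\<close>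

locale normal_semigroup = contraction_semigroup H ip S
  for H :: "'v::real_vector set" and ip :: "'v \<Rightarrow> 'v \<Rightarrow> real" and S :: "real \<Rightarrow> 'v \<Rightarrow> 'v" +
  fixes D :: "'v set" and A A' :: "'v \<Rightarrow> 'v" and one :: 'v
  assumes complete: "\<lbrakk>\<And>n. X n \<in> H; \<And>e. e > 0 \<Longrightarrow> \<exists>M. \<forall>m\<ge>M. \<forall>n\<ge>M. nrm (X m - X n) < e\<rbrakk>
      \<Longrightarrow> \<exists>x. conv X x sequentially"
    and D_iff: "f \<in> D \<longleftrightarrow> (\<exists>h. gen f h)"
    and A_gen: "f \<in> D \<Longrightarrow> gen f (A f)"
    and D_adj_iff: "f \<in> D \<longleftrightarrow> f \<in> H \<and> (\<exists>h\<in>H. \<forall>u\<in>D. ip (A u) f = ip u h)"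
    and A'_H: "f \<in> D \<Longrightarrow> A' f \<in> H"
    and A_adj: "\<lbrakk>f \<in> D; u \<in> D\<rbrakk> \<Longrightarrow> ip (A u) f = ip u (A' f)"
    and normal: "f \<in> D \<Longrightarrow> nrm (A f) = nrm (A' f)"
    and one_H: "one \<in> H" and ip_one_one: "ip one one = 1"
    and S_one: "t \<ge> 0 \<Longrightarrow> S t one \<doteq> one"
    and ip_S_one: "\<lbrakk>t \<ge> 0; f \<in> H\<rbrakk> \<Longrightarrow> ip (S t f) one = ip f one"
begin

lemma D_H: "f \<in> D \<Longrightarrow> f \<in> H"
  using A_gen gen_H by blast

lemma A_H: "f \<in> D \<Longrightarrow> A f \<in> H"
  using A_gen gen_H by blast

lemma gen_D: "gen f h \<Longrightarrow> f \<in> D"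
  using D_iff by blast

lemma A_eqv: "gen f h \<Longrightarrow> A f \<doteq> h"
  using A_gen gen_D gen_unique by blast

lemma D_cong: "\<lbrakk>f \<in> D; f' \<in> H; f \<doteq> f'\<rbrakk> \<Longrightarrow> f' \<in> D \<and> A f' \<doteq> A f"
  using gen_cong[OF A_gen, of f f' "A f"] A_H A_eqv gen_D by auto

lemma S_D: "\<lbrakk>t \<ge> 0; f \<in> D\<rbrakk> \<Longrightarrow> S t f \<in> D \<and> A (S t f) \<doteq> S t (A f)"
  using gen_S[OF A_gen] gen_D A_eqv by blast

lemma D_add: "\<lbrakk>f \<in> D; g \<in> D\<rbrakk> \<Longrightarrow> f + g \<in> D \<and> A (f + g) \<doteq> A f + A g"
  using gen_add[OF A_gen A_gen] gen_D A_eqv by blast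

lemma D_scale: "f \<in> D \<Longrightarrow> a *\<^sub>R f \<in> D \<and> A (a *\<^sub>R f) \<doteq> a *\<^sub>R A f"
  using gen_scale[OF A_gen] gen_D A_eqv by blast

lemma zero_D: "0 \<in> D"
proof -
  have "gen 0 0"
    unfolding gen_def
  proof (intro conjI convI)
    show "\<forall>\<^sub>F t in at_right 0. nrm ((1 / t) *\<^sub>R (S t 0 - 0) - 0) \<le> 0"
      using eventually_gt_0
    proof eventually_elim
      fix t :: real assume t: "0 < t"
      then have "nrm (S t 0) \<le> 0" using S_contraction[of t 0] by simp
      then show "nrm ((1 / t) *\<^sub>R (S t 0 - 0) - 0) \<le> 0"
        using t by (simp add: nrm_scale divide_le_0_iff)
    qed
    show "\<forall>\<^sub>F t in at_right 0. (1 / t) *\<^sub>R (S t 0 - 0) \<in> H"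
      using eventually_gt_0 by eventually_elim simp
  qed auto
  then show ?thesis by (rule gen_D)
qed

lemma subspace_D: "subspace D"
  unfolding subspace_def using zero_D D_add D_scale by blast

text \<open>No density argument is needed: since \<^term>\<open>A u\<close> is a limit of elements of \<^term>\<open>D\<close>,
  a vector orthogonal to \<^term>\<open>D\<close> has adjoint value \<open>0\<close>, so it lies in the domain of
  the adjoint, which by normality is \<^term>\<open>D\<close> itself.\<close>

lemma D_orthogonal:
  assumes q: "q \<in> H" "\<And>u. u \<in> D \<Longrightarrow> ip u q = 0"
  shows "q \<doteq> 0"
proof -
  have "ip (A u) q = 0" if u: "u \<in> D" for u
  proof -
    have uH: "u \<in> H" using u by (rule D_H)
    have "((\<lambda>t. ip ((1 / t) *\<^sub>R (S t u - u)) q) \<longlongrightarrow> ip (A u) q) (at_right 0)"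
      using A_gen[OF u] q by (intro conv_ip conv_const) (auto simp: gen_def)
    moreover have "\<forall>\<^sub>F t in at_right 0. ip ((1 / t) *\<^sub>R (S t u - u)) q = 0"
      using eventually_gt_0
    proof eventually_elim
      fix t :: real assume t: "0 < t"
      then have "ip (S t u) q = 0" using S_D[of t u] u q(2) by auto
      then show "ip ((1 / t) *\<^sub>R (S t u - u)) q = 0" using t q uH u by (simp add: ip_simps)
    qed
    ultimately have "((\<lambda>t. 0) \<longlongrightarrow> ip (A u) q) (at_right (0::real))"
      by (rule Lim_transform_eventually)
    then show ?thesis using tendsto_unique[OF _ _ tendsto_const[of 0 "at_right (0::real)"]] by simp
  qed
  then have "q \<in> D" using q by (subst D_adj_iff) (auto simp: ip_zero_right D_H intro!: bexI[of _ 0])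
  then have "ip q q = 0" by (rule q(2))
  then show ?thesis using q(1) by (rule eqv_ip_zero[rotated])
qed

text \<open>Uniqueness of adjoint values, modulo null vectors: the difference of two candidates is
  orthogonal to \<open>D\<close>.\<close>

lemma A'_eqv:
  assumes "f \<in> D" "h \<in> H" "\<And>u. u \<in> D \<Longrightarrow> ip (A u) f = ip u h"
  shows "A' f \<doteq> h"
proof -
  have "A' f - h \<doteq> 0"
    using assms A'_H[OF assms(1)] A_adj[OF assms(1)] D_H
    by (intro D_orthogonal) (auto simp: ip_simps)
  then show ?thesis by (simp add: eqv_def)
qed

lemma A'_add: "\<lbrakk>f \<in> D; g \<in> D\<rbrakk> \<Longrightarrow> A' (f + g) \<doteq> A' f + A' g"
  using subspace_add[OF subspace_D]
  by (intro A'_eqv) (auto simp: ip_simps A'_H A_H D_H A_adj)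

text \<open>Polarization: expand the equality of norms for \<open>u + v\<close> and remove the
  square terms, which agree by normality at \<open>u\<close> and at \<open>v\<close>.\<close>

lemma A_A'_polar:
  assumes u: "u \<in> D" and v: "v \<in> D"
  shows "ip (A' u) (A' v) = ip (A u) (A v)"
proof -
  have H: "A u \<in> H" "A v \<in> H" "A' u \<in> H" "A' v \<in> H" using u v by (auto simp: A_H A'_H)
  have uv: "u + v \<in> D" using subspace_add[OF subspace_D u v] .
  have "nrm (A u + A v) = nrm (A (u + v))"
    using D_add[OF u v] H A_H[OF uv] by (intro nrm_cong[symmetric]) auto
  also have "\<dots> = nrm (A' (u + v))" using uv by (rule normal)
  also have "\<dots> = nrm (A' u + A' v)"
    using A'_add[OF u v] H A'_H[OF uv] by (intro nrm_cong) auto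
  finally have "ip (A u + A v) (A u + A v) = ip (A' u + A' v) (A' u + A' v)"
    using H by (simp flip: nrm_sq)
  moreover have "ip (A u) (A u) = ip (A' u) (A' u)" "ip (A v) (A v) = ip (A' v) (A' v)"
    using normal[OF u] normal[OF v] H by (simp_all flip: nrm_sq)
  ultimately show ?thesis
    using H by (simp add: ip_simps ip_commute[of "A v" "A u"] ip_commute[of "A' v" "A' u"])
qed

text \<open>The pair \<^term>\<open>(A' f, A' (A f))\<close> is projected onto the closed graph of the generator. By normality
  the residual \<open>(w, p)\<close> satisfies both \<open>A' p = - w\<close> and \<open>ip (A' u) w = ip u p\<close> on \<^term>\<open>D\<close>;
  taking \<open>u = p\<close> shows that it vanishes.\<close>

lemma gen_A':
  assumes f: "f \<in> D" and Af: "A f \<in> D"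
  shows "gen (A' f) (A' (A f))"
proof -
  let ?ip2 = "\<lambda>p q. ip (fst p) (fst q) + ip (snd p) (snd q)"
  interpret P: semi_inner "H \<times> H" ?ip2
    by (rule semi_inner_Times) (rule semi_inner_axioms)
  define G where "G = {p. gen (fst p) (snd p)}"
  have GH: "G \<subseteq> H \<times> H" using gen_H by (auto simp: G_def)
  have P_nrm: "(P.nrm p)\<^sup>2 = (nrm (fst p))\<^sup>2 + (nrm (snd p))\<^sup>2" if "p \<in> H \<times> H" for p
    using that P.nrm_sq[OF that] by (auto simp: nrm_sq)
  \<comment> \<open>The product seminorm and those of the two components control each other, so
    completeness of the graph can be checked by components.\<close>
  have fst_le: "nrm (fst p) \<le> P.nrm p" and snd_le: "nrm (snd p) \<le> P.nrm p"
    and P_le: "P.nrm p \<le> nrm (fst p) + nrm (snd p)" if p: "p \<in> H \<times> H" for p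
  proof -
    have nn: "0 \<le> nrm (fst p)" "0 \<le> nrm (snd p)" "0 \<le> P.nrm p" using p P.nrm_ge_0[OF p] by auto
    show "nrm (fst p) \<le> P.nrm p" "nrm (snd p) \<le> P.nrm p"
      using P_nrm[OF p] nn by (auto intro: power2_le_imp_le[OF _ nn(3)])
    show "P.nrm p \<le> nrm (fst p) + nrm (snd p)"
      using P_nrm[OF p] nn by (intro power2_le_imp_le[OF _ add_nonneg_nonneg]) (auto simp: power2_sum)
  qed
  let ?w = "A' f" and ?h = "A' (A f)"
  have wh: "?w \<in> H" "?h \<in> H" using f Af by (auto simp: A'_H)
  have "\<exists>y\<in>G. \<forall>u\<in>G. ?ip2 ((?w, ?h) - y) u = 0"
  proof (rule P.projection)
    show "subspace G"
      unfolding subspace_def G_def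
      using gen_add gen_scale gen_scale[OF A_gen[OF zero_D], of 0] by auto
    show "(?w, ?h) \<in> H \<times> H" using wh by simp
    fix X :: "nat \<Rightarrow> 'v \<times> 'v"
    assume X: "\<And>n. X n \<in> G" and
      cauchy: "\<And>e. e > 0 \<Longrightarrow> \<exists>M. \<forall>m\<ge>M. \<forall>n\<ge>M. P.nrm (X m - X n) < e"
    have XH: "X n \<in> H \<times> H" for n using X GH by auto
    have dXH: "X m - X n \<in> H \<times> H" for m n using XH P.H_closed by blast
    have "\<exists>x. conv (\<lambda>n. fst (X n)) x sequentially"
    proof (rule complete)
      show "fst (X n) \<in> H" for n using XH[of n] by auto
      show "\<exists>M. \<forall>m\<ge>M. \<forall>n\<ge>M. nrm (fst (X m) - fst (X n)) < e" if "e > 0" for e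
        using cauchy[OF that] fst_le[OF dXH] by (simp, meson le_less_trans)
    qed
    moreover have "\<exists>x. conv (\<lambda>n. snd (X n)) x sequentially"
    proof (rule complete)
      show "snd (X n) \<in> H" for n using XH[of n] by auto
      show "\<exists>M. \<forall>m\<ge>M. \<forall>n\<ge>M. nrm (snd (X m) - snd (X n)) < e" if "e > 0" for e
        using cauchy[OF that] snd_le[OF dXH] by (simp, meson le_less_trans)
    qed
    ultimately obtain x y where xy: "conv (\<lambda>n. fst (X n)) x sequentially" "conv (\<lambda>n. snd (X n)) y sequentially"
      by blast
    have "gen x y" using X xy by (auto simp: G_def intro: gen_closed[of "\<lambda>n. fst (X n)" "\<lambda>n. snd (X n)"])
    moreover have "P.conv X (x, y) sequentially"
    proof (rule P.convI)
      have xyH: "x \<in> H" "y \<in> H" using xy by (auto simp: conv_def)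
      then show "(x, y) \<in> H \<times> H" by simp
      then have "X n - (x, y) \<in> H \<times> H" for n using XH P.H_closed by blast
      from P_le[OF this] show "\<forall>\<^sub>F n in sequentially. P.nrm (X n - (x, y)) \<le>
          nrm (fst (X n) - x) + nrm (snd (X n) - y)" by simp
      show "(\<lambda>n. nrm (fst (X n) - x) + nrm (snd (X n) - y)) \<longlonglongrightarrow> 0"
        using xy tendsto_add[of _ 0 sequentially _ 0] by (auto simp: conv_def)
    qed (use XH in auto)
    ultimately show "\<exists>y\<in>G. P.conv X y sequentially" by (auto simp: G_def)
  qed (rule GH)
  then obtain v k where vk: "gen v k"
    and orth: "\<And>u. u \<in> D \<Longrightarrow> ip (?w - v) u + ip (?h - k) (A u) = 0"
    using A_gen by (force simp: G_def)
  have vkH: "v \<in> H" "k \<in> H" and vD: "v \<in> D" using vk gen_H gen_D by auto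
  define w p where "w = ?w - v" and "p = ?h - k"
  have H: "w \<in> H" "p \<in> H" using wh vkH by (auto simp: w_def p_def)
  have adj: "ip (A u) p = ip u (- w)" if "u \<in> D" for u
    using orth[OF that] H D_H[OF that] A_H[OF that]
    by (simp add: ip_simps ip_commute[of w u] ip_commute[of p "A u"] flip: w_def p_def)
  have pD: "p \<in> D" using H adj by (subst D_adj_iff) (auto intro!: bexI[of _ "- w"])
  have A'p: "A' p \<doteq> - w" using H adj pD by (intro A'_eqv) auto
  \<comment> \<open>Polarized normality replaces the left side by \<open>ip (A p) (A f)\<close>;
    since \<open>A f\<close> is in \<open>D\<close>, one more use of the adjoint leads to the right
    side.\<close>
  have "ip (A' p) ?w = ip p ?h"
    using A_A'_polar[OF pD f] A_adj[OF Af pD] by simp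
  moreover have "ip (A' p) v = ip p k"
  proof -
    have "ip (A' p) v = ip (A v) p"
      using A_adj[OF pD vD] vkH A'_H[OF pD] by (simp add: ip_commute[of v "A' p"])
    also have "\<dots> = ip k p" using A_eqv[OF vk] vkH H A_H[OF vD] by (intro ip_cong_left) auto
    finally show ?thesis using vkH H by (simp add: ip_commute[of k p])
  qed
  ultimately have "ip (A' p) w = ip p p"
    using wh vkH H A'_H[OF pD] by (simp add: ip_simps w_def p_def)
  moreover have "ip (A' p) w = - ip w w"
    using ip_cong_left[OF _ _ _ A'p] H A'_H[OF pD] by (simp add: ip_simps)
  moreover have "0 \<le> ip p p" "0 \<le> ip w w" using H by (auto intro: ip_ge_0)
  ultimately have "ip p p = 0" "ip w w = 0" by linarith+
  then have "w \<doteq> 0" "p \<doteq> 0" using H eqv_ip_zero by auto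
  then have "v \<doteq> ?w" "k \<doteq> ?h"
    using wh vkH by (auto simp: eqv_def w_def p_def nrm_diff_commute)
  then show ?thesis using gen_cong[OF vk] wh by auto
qed

section \<open>The smooth domain and its invariance\<close>

definition Dinf :: "'v set" where "Dinf = {f. \<forall>k. (A ^^ k) f \<in> D}"

lemma Dinf_D: "f \<in> Dinf \<Longrightarrow> f \<in> D"
  unfolding Dinf_def by (drule CollectD, drule spec[of _ 0]) simp

lemma Dinf_H: "f \<in> Dinf \<Longrightarrow> f \<in> H"
  by (simp add: Dinf_D D_H)

lemma Dinf_A: "f \<in> Dinf \<Longrightarrow> A f \<in> Dinf"
  unfolding Dinf_def by (clarify, drule_tac x = "Suc k" in spec) (simp add: funpow_swap1)

text \<open>\<open>A\<close> respects sums, multiples, \<open>S t\<close> and \<open>A'\<close> only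
  modulo null vectors, so an iterate of \<open>f + g\<close>, say, need not be a sum of iterates.
  Coinduction up to \<open>\<doteq>\<close> absorbs the discrepancy: each iterate stays equivalent
  to a member of \<open>Y\<close>, and \<open>D\<close> is closed under equivalence.\<close>

lemma Dinf_coinduct:
  assumes "f \<in> Y" "Y \<subseteq> D" "\<And>f. f \<in> Y \<Longrightarrow> \<exists>f'\<in>Y. A f \<doteq> f'"
  shows "f \<in> Dinf"
proof -
  have "(A ^^ k) f \<in> H \<and> (\<exists>f'\<in>Y. (A ^^ k) f \<doteq> f')" for k
  proof (induction k)
    case 0
    then show ?case using assms D_H by force
  next
    case (Suc k)
    then obtain f' where f': "(A ^^ k) f \<in> H" "f' \<in> Y" "(A ^^ k) f \<doteq> f'" by blast
    then have f'D: "f' \<in> D" using assms by blast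
    have k: "(A ^^ k) f \<in> D" "A ((A ^^ k) f) \<doteq> A f'"
      using D_cong[OF f'D f'(1)] f' D_H[OF f'D] eqv_sym by auto
    obtain f'' where f'': "f'' \<in> Y" "A f' \<doteq> f''" using assms(3) f' by blast
    have f''D: "f'' \<in> D" using assms f'' by blast
    have "A ((A ^^ k) f) \<doteq> f''"
      using k(2) f''(2) by (rule eqv_trans[rotated -2]) (auto intro: A_H D_H k f'D f''D)
    then show ?case using f'' k A_H by auto
  qed
  moreover have "x \<in> D" if "x \<in> H" "f' \<in> Y" "x \<doteq> f'" for x f'
    using that assms(2) D_cong[of f' x] D_H eqv_sym by blast
  ultimately show ?thesis unfolding Dinf_def by blast
qed

lemma Dinf_cong:
  assumes "f \<in> Dinf" "f' \<in> H" "f \<doteq> f'"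
  shows "f' \<in> Dinf"
proof (rule Dinf_coinduct)
  let ?Y = "{f' \<in> H. \<exists>f\<in>Dinf. f \<doteq> f'}"
  show "f' \<in> ?Y" using assms by blast
  show "?Y \<subseteq> D" using D_cong Dinf_D by blast
  fix f assume "f \<in> ?Y"
  then obtain f0 where f0: "f0 \<in> Dinf" "f0 \<doteq> f" "f \<in> H" by blast
  then have "A f \<doteq> A f0" using D_cong Dinf_D by blast
  moreover have "A f0 \<in> ?Y" using f0 Dinf_A Dinf_H eqv_refl by blast
  ultimately show "\<exists>f'\<in>?Y. A f \<doteq> f'" by blast
qed

lemma Dinf_add: "f \<in> Dinf \<Longrightarrow> g \<in> Dinf \<Longrightarrow> f + g \<in> Dinf"
  using Dinf_coinduct[of "f + g" "{f + g | f g. f \<in> Dinf \<and> g \<in> Dinf}"] D_add Dinf_D Dinf_A by blast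

lemma Dinf_scale: "f \<in> Dinf \<Longrightarrow> a *\<^sub>R f \<in> Dinf"
  using Dinf_coinduct[of "a *\<^sub>R f" "{a *\<^sub>R f | f. f \<in> Dinf}"] D_scale Dinf_D Dinf_A by blast

lemma Dinf_S: "t \<ge> 0 \<Longrightarrow> f \<in> Dinf \<Longrightarrow> S t f \<in> Dinf"
  using Dinf_coinduct[of "S t f" "{S t f | f. f \<in> Dinf}"] S_D Dinf_D Dinf_A by blast

text \<open>By \<open>gen_A'\<close>, \<open>A (A' f) \<doteq> A' (A f)\<close>, so the image of
  \<open>Dinf\<close> under \<open>A'\<close> is invariant under \<open>A\<close> up to
  equivalence.\<close>

lemma Dinf_A': "f \<in> Dinf \<Longrightarrow> A' f \<in> Dinf"
  using Dinf_coinduct[of "A' f" "{A' f | f. f \<in> Dinf}"] gen_A' gen_D A_eqv Dinf_D Dinf_A by blast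

lemma subspace_Dinf: "subspace Dinf"
proof -
  have "0 \<in> Dinf"
    using Dinf_coinduct[of 0 "{0}"] zero_D D_scale[OF zero_D, of 0] by auto
  then show ?thesis unfolding subspace_def using Dinf_add Dinf_scale by blast
qed

definition B :: "'v \<Rightarrow> 'v" where "B f = (-1) *\<^sub>R (A f + A' f)"

lemma Dinf_B: "f \<in> Dinf \<Longrightarrow> B f \<in> Dinf"
  unfolding B_def by (intro Dinf_scale Dinf_add Dinf_A Dinf_A')

lemma A_B: assumes f: "f \<in> Dinf" shows "A (B f) \<doteq> B (A f)"
proof -
  note D = Dinf_D Dinf_A Dinf_A' Dinf_add Dinf_scale Dinf_H f
  have H: "A (A f + A' f) \<in> H" "A (A f) + A (A' f) \<in> H" "A (A f) + A' (A f) \<in> H" "A (A' f) \<in> H"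
    using D by (auto intro!: A_H A'_H H_closed)
  have "A (A f + A' f) \<doteq> A (A f) + A (A' f)" using D_add D by blast
  moreover have "A (A f) + A (A' f) \<doteq> A (A f) + A' (A f)"
    using D by (intro eqv_add eqv_refl A_eqv[OF gen_A']) (auto intro: A_H A'_H)
  ultimately have "A (A f + A' f) \<doteq> A (A f) + A' (A f)"
    by (rule eqv_trans[rotated -2]) (use H in auto)
  then have 2: "(-1) *\<^sub>R A (A f + A' f) \<doteq> B (A f)"
    unfolding B_def using H by (intro eqv_scale) auto
  have 1: "A (B f) \<doteq> (-1) *\<^sub>R A (A f + A' f)"
    unfolding B_def using D_scale[OF Dinf_D[OF Dinf_add[OF Dinf_A[OF f] Dinf_A'[OF f]]]] by blast
  show ?thesis
    by (rule eqv_trans[OF _ _ _ 1 2])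
      (use H A_H[OF Dinf_D[OF Dinf_B[OF f]]] Dinf_H[OF Dinf_B[OF Dinf_A[OF f]]] in auto)
qed

lemma A_one: "one \<in> D" "A one \<doteq> 0"
proof -
  have "gen one 0"
    unfolding gen_def
  proof (intro conjI convI)
    show "\<forall>\<^sub>F t in at_right 0. nrm ((1 / t) *\<^sub>R (S t one - one) - 0) \<le> 0"
      using eventually_gt_0
      by eventually_elim (use S_one one_H in \<open>auto simp: nrm_scale eqv_def\<close>)
    show "\<forall>\<^sub>F t in at_right 0. (1 / t) *\<^sub>R (S t one - one) \<in> H"
      using eventually_gt_0 by eventually_elim (use one_H in auto)
  qed (use one_H in auto)
  then show "one \<in> D" "A one \<doteq> 0" using gen_D A_eqv by auto
qed

lemma ip_A_one: assumes "f \<in> D" shows "ip (A f) one = 0"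
proof -
  have f: "f \<in> H" using assms by (rule D_H)
  have "((\<lambda>t. ip ((1 / t) *\<^sub>R (S t f - f)) one) \<longlongrightarrow> ip (A f) one) (at_right 0)"
    using A_gen[OF assms] one_H by (intro conv_ip conv_const) (auto simp: gen_def)
  moreover have "\<forall>\<^sub>F t in at_right 0. ip ((1 / t) *\<^sub>R (S t f - f)) one = 0"
    using eventually_gt_0 by eventually_elim (use f one_H ip_S_one in \<open>simp add: ip_simps\<close>)
  ultimately have "((\<lambda>t. 0) \<longlongrightarrow> ip (A f) one) (at_right (0::real))"
    by (rule Lim_transform_eventually)
  then show ?thesis using tendsto_unique[OF _ _ tendsto_const[of 0 "at_right (0::real)"]] by simp
qed

text \<open>Together with \<open>ip_A_one\<close> this removes the product of means after one step:
  both \<open>A f\<close> and \<open>B f\<close> have mean 0, so only inner products survive in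
  \<open>E 1\<close>.\<close>

lemma ip_A'_one: assumes "f \<in> D" shows "ip (A' f) one = 0"
proof -
  have "ip (A' f) one = ip (A one) f"
    using A_adj[OF assms A_one(1)] assms by (simp add: ip_commute one_H A'_H)
  also have "\<dots> = ip 0 f" using A_one assms D_H A_H by (intro ip_cong_left) auto
  finally show ?thesis using assms by (simp add: ip_zero_left D_H)
qed

section \<open>Energies: symmetry, positivity and log-convexity\<close>

primrec E :: "nat \<Rightarrow> 'v \<Rightarrow> 'v \<Rightarrow> real" where
  "E 0 = (\<lambda>f g. ip f g - ip f one * ip g one)"
| "E (Suc n) = (\<lambda>f g. - E n (A f) g - E n f (A g))"

lemma E_commute: "f \<in> Dinf \<Longrightarrow> g \<in> Dinf \<Longrightarrow> E n f g = E n g f"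
  by (induction n arbitrary: f g) (auto simp: Dinf_A Dinf_H ip_commute)

lemma E_cong: "\<lbrakk>f \<in> Dinf; f' \<in> Dinf; g \<in> Dinf; f \<doteq> f'\<rbrakk> \<Longrightarrow> E n f g = E n f' g"
proof (induction n arbitrary: f f' g)
  case 0
  then show ?case using ip_cong_left[of f f' g] ip_cong_left[of f f' one] one_H by (simp add: Dinf_H)
next
  case (Suc n)
  have "A f' \<doteq> A f" using D_cong[of f f'] Suc.prems Dinf_D Dinf_H by blast
  then show ?case
    using Suc.IH[of "A f'" "A f" g] Suc.IH[of f f' "A g"] Suc.prems Dinf_A by simp
qed

lemma E_add: "\<lbrakk>f \<in> Dinf; f' \<in> Dinf; g \<in> Dinf\<rbrakk> \<Longrightarrow> E n (f + f') g = E n f g + E n f' g"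
proof (induction n arbitrary: f f' g)
  case 0
  then show ?case by (simp add: ip_simps Dinf_H one_H algebra_simps)
next
  case (Suc n)
  have "E n (A (f + f')) g = E n (A f + A f') g"
    using Suc.prems D_add[of f f'] by (intro E_cong) (auto simp: Dinf_A Dinf_D Dinf_add)
  then show ?case using Suc by (simp add: Dinf_A)
qed

lemma E_scale: "\<lbrakk>f \<in> Dinf; g \<in> Dinf\<rbrakk> \<Longrightarrow> E n (a *\<^sub>R f) g = a * E n f g"
proof (induction n arbitrary: f g)
  case 0
  then show ?case by (simp add: ip_simps Dinf_H one_H algebra_simps)
next
  case (Suc n)
  have "E n (A (a *\<^sub>R f)) g = E n (a *\<^sub>R A f) g"
    using Suc.prems D_scale[of f a] by (intro E_cong) (auto simp: Dinf_A Dinf_D Dinf_scale)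
  then show ?case using Suc by (simp add: Dinf_A algebra_simps)
qed

text \<open>At level 0 the means drop out and the adjoint moves \<open>A\<close> from
  \<open>g\<close> to \<open>f\<close>. The induction step applies the hypothesis to
  \<open>A f\<close>, which produces \<open>B (A f)\<close>; commutation turns this into
  \<open>A (B f)\<close>, as the recursion for \<open>E\<close> at \<open>B f\<close>
  demands.\<close>

lemma E_B: "\<lbrakk>f \<in> Dinf; g \<in> Dinf\<rbrakk> \<Longrightarrow> E (Suc n) f g = E n (B f) g"
proof (induction n arbitrary: f g)
  case 0
  note D = 0 Dinf_D[OF 0(1)] Dinf_D[OF 0(2)] Dinf_H[OF 0(1)] Dinf_H[OF 0(2)]
  have "ip f (A g) = ip (A' f) g" using A_adj[of f g] D by (simp add: ip_commute A_H A'_H)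
  then show ?case
    using D by (simp add: B_def ip_simps A_H A'_H one_H ip_A_one ip_A'_one)
next
  case (Suc n)
  have "E n (B (A f)) g = E n (A (B f)) g"
    using Suc.prems A_B[of f] by (intro E_cong) (auto intro: Dinf_A Dinf_B Dinf_H eqv_sym)
  moreover have "E (Suc (Suc n)) f g = - E n (B (A f)) g - E n (B f) (A g)"
    unfolding E.simps(2)[of "Suc n"] using Suc by (simp only: Dinf_A)
  ultimately show ?case by simp
qed

text \<open>Symmetry and two uses of \<open>E_B\<close> give
  \<open>E (n + 2) f f = E n (B f) (B f)\<close>, hence an induction in steps of two. Its base cases
  are the variance, nonnegative by Cauchy-Schwarz against the unit vector \<open>one\<close>, and
  dissipativity of the generator.\<close>

lemma E_nonneg: "f \<in> Dinf \<Longrightarrow> 0 \<le> E n f f"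
proof (induction n arbitrary: f rule: induct_nat_012)
  case 0
  then show ?case
    using Cauchy_Schwarz_sq[OF Dinf_H[OF 0] one_H] ip_one_one by (simp add: power2_eq_square)
next
  case 1
  then show ?case
    using gen_dissipative[OF A_gen[OF Dinf_D[OF 1]]] ip_A_one[OF Dinf_D[OF 1]]
    by (simp add: ip_commute[of f "A f"] Dinf_H Dinf_A)
next
  case (ge2 n)
  have "E (Suc (Suc n)) f f = E n (B f) (B f)"
    using ge2.prems E_B[of f f "Suc n"] E_B[of f "B f" n] E_commute[of "B f" f "Suc n"] Dinf_B by simp
  then show ?case using ge2 Dinf_B by simp
qed

lemma E_log_convex:
  assumes f: "f \<in> Dinf"
  shows "(E (Suc n) f f)\<^sup>2 \<le> E n f f * E (Suc (Suc n)) f f"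
proof -
  \<comment> \<open>The energy itself now serves as a degenerate inner product on
    \<open>Dinf\<close>; its Cauchy-Schwarz inequality is used at \<open>B f\<close> and
    \<open>f\<close>.\<close>
  interpret E: semi_inner Dinf "E n"
    by unfold_locales (auto simp: subspace_Dinf E_add E_scale E_nonneg intro: E_commute)
  have "E (Suc (Suc n)) f f = E n (B f) (B f)"
    using f E_B[of f f "Suc n"] E_B[of f "B f" n] E_commute[of "B f" f "Suc n"] Dinf_B by simp
  moreover have "E (Suc n) f f = E n (B f) f" using f E_B by simp
  ultimately show ?thesis
    using E.Cauchy_Schwarz_sq[OF Dinf_B[OF f] f] by (simp add: mult.commute)
qed

section \<open>Solutions of the Cauchy problem\<close>

lemma solution_eqv_S:
  assumes "\<And>t. t \<ge> 0 \<Longrightarrow> g t \<in> D \<and> has_der g (A (g t)) t" "g 0 \<doteq> g0" "g0 \<in> D" "t \<ge> 0"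
  shows "g t \<doteq> S t g0"
proof -
  have g0: "g0 \<in> H" using assms(3) by (rule D_H)
  \<comment> \<open>The solution and the semigroup orbit both satisfy the equation, and the graph is
    linear, so dissipativity applies to their difference.\<close>
  have "g t - S t g0 \<doteq> 0"
  proof (rule dissipative_flow_zero[where w = "\<lambda>t. g t - S t g0" and w' = "\<lambda>t. A (g t) - S t (A g0)"])
    fix t :: real assume t: "t \<ge> 0"
    show "has_der (\<lambda>t. g t - S t g0) (A (g t) - S t (A g0)) t"
      using t assms(1) A_gen[OF assms(3)] by (intro has_der_diff S_has_der) auto
    have "gen (g t - S t g0) (A (g t) - S t (A g0))"
      using gen_add[OF A_gen gen_scale[OF gen_S[OF A_gen[OF assms(3)] t], of "-1"], of "g t"] assms(1)[OF t]
      by simp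
    then show "ip (A (g t) - S t (A g0)) (g t - S t g0) \<le> 0" by (rule gen_dissipative)
  next
    have "S 0 g0 \<doteq> g0" using g0 by (rule S_zero)
    moreover have "g 0 \<in> H" using assms(1)[of 0] D_H by auto
    ultimately have "g 0 \<doteq> S 0 g0"
      using assms(2) g0 by (intro eqv_trans[of "g 0" g0 "S 0 g0"] eqv_sym[of "S 0 g0"]) auto
    then show "g 0 - S 0 g0 \<doteq> 0" by (simp add: eqv_def)
  qed (rule assms(4))
  then show ?thesis by (simp add: eqv_def)
qed

context
  fixes g :: "real \<Rightarrow> 'v" and g0 :: 'v
  assumes g: "\<And>t. t \<ge> 0 \<Longrightarrow> g t \<in> D \<and> has_der g (A (g t)) t" "g 0 \<doteq> g0" "g0 \<in> Dinf"
begin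

text \<open>The facts about \<open>E\<close> need arguments in \<open>Dinf\<close>, while a solution
  is only assumed to lie in \<open>D\<close>. Uniqueness and the invariance of \<open>Dinf\<close>
  under \<open>S t\<close> supply the missing regularity.\<close>

lemma solution_iterates:
  assumes "t \<ge> 0"
  shows "(A ^^ k) (g t) \<in> Dinf" "(A ^^ k) (g t) \<doteq> S t ((A ^^ k) g0)"
proof -
  have g0k: "(A ^^ k) g0 \<in> Dinf" for k by (induction k) (auto simp: g Dinf_A)
  have "(A ^^ k) (g t) \<in> Dinf \<and> (A ^^ k) (g t) \<doteq> S t ((A ^^ k) g0)"
  proof (induction k)
    case 0
    have e: "g t \<doteq> S t g0" using solution_eqv_S g Dinf_D assms by blast
    have H: "g t \<in> H" "S t g0 \<in> H" using g(1)[OF assms] D_H g(3) Dinf_H assms by auto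
    then have "g t \<in> Dinf" using Dinf_cong[OF Dinf_S[OF assms g(3)]] eqv_sym[OF H e] by auto
    with e show ?case by simp
  next
    case (Suc k)
    have SD: "S t ((A ^^ k) g0) \<in> D" "A (S t ((A ^^ k) g0)) \<doteq> S t (A ((A ^^ k) g0))"
      using S_D[OF assms Dinf_D[OF g0k]] by auto
    have "A (S t ((A ^^ k) g0)) \<doteq> A ((A ^^ k) (g t))"
      using D_cong[of "(A ^^ k) (g t)" "S t ((A ^^ k) g0)"] Suc SD Dinf_D D_H by blast
    moreover have H: "A ((A ^^ k) (g t)) \<in> H" "A (S t ((A ^^ k) g0)) \<in> H" "S t (A ((A ^^ k) g0)) \<in> H"
      using A_H[OF SD(1)] A_H[OF Dinf_D] Suc g0k[of k] assms by auto
    ultimately have "A ((A ^^ k) (g t)) \<doteq> A (S t ((A ^^ k) g0))" by (intro eqv_sym[OF H(2,1)])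
    from eqv_trans[OF H this SD(2)] have "A ((A ^^ k) (g t)) \<doteq> S t (A ((A ^^ k) g0))" .
    then show ?case using Suc Dinf_A by auto
  qed
  then show "(A ^^ k) (g t) \<in> Dinf" "(A ^^ k) (g t) \<doteq> S t ((A ^^ k) g0)" by auto
qed

text \<open>\<open>A\<close> need not be continuous, so it cannot be applied to the limit of
  difference quotients of \<open>g\<close>. Instead the derivative is taken along the orbit of
  \<open>(A ^^ k) g0\<close>, which lies in \<open>D\<close>, and transferred to the equivalent
  curve.\<close>

lemma solution_iterates_has_der:
  assumes t: "t \<ge> 0"
  shows "has_der (\<lambda>s. (A ^^ k) (g s)) ((A ^^ Suc k) (g t)) t"
proof (rule has_der_cong)
  have g0k: "(A ^^ k) g0 \<in> Dinf" for k by (induction k) (auto simp: g Dinf_A)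
  show "has_der (\<lambda>s. S s ((A ^^ k) g0)) (S t (A ((A ^^ k) g0))) t"
    using t by (intro S_has_der A_gen Dinf_D g0k)
  show "S s ((A ^^ k) g0) \<doteq> (A ^^ k) (g s)" if "s \<ge> 0" for s
    using solution_iterates[OF that, of k] that g0k[of k] Dinf_H by (intro eqv_sym[of "(A ^^ k) (g s)"]) auto
  show "S t (A ((A ^^ k) g0)) \<doteq> (A ^^ Suc k) (g t)"
    using solution_iterates[OF t, of "Suc k"] t g0k[of "Suc k"] Dinf_H
    by (intro eqv_sym[of "(A ^^ Suc k) (g t)"]) auto
qed (use t solution_iterates(1) Dinf_H Dinf_A in auto)

text \<open>Two independent exponents are needed for the induction, because the recursion of
  \<open>E\<close> applies \<open>A\<close> to one argument at a time. The energies along the flow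
  are the case \<open>j = k = 0\<close>.\<close>

lemma E_has_derivative:
  assumes t: "t \<ge> 0"
  shows "((\<lambda>s. E m ((A ^^ j) (g s)) ((A ^^ k) (g s))) has_real_derivative
    - E (Suc m) ((A ^^ j) (g t)) ((A ^^ k) (g t))) (at t within {0..})"
proof (induction m arbitrary: j k)
  case 0
  note der = solution_iterates_has_der[OF t]
  show ?case
    using DERIV_diff[OF has_der_ip[OF der[of j] der[of k] t]
        DERIV_mult[OF has_der_ip[OF der[of j] has_der_const[OF one_H] t]
          has_der_ip[OF der[of k] has_der_const[OF one_H] t]]]
      solution_iterates(1)[OF t] Dinf_H
    by (simp add: ip_zero_right algebra_simps)
next
  case (Suc m)
  show ?case
    using DERIV_diff[OF DERIV_minus[OF Suc[of "Suc j" k]] Suc[of j "Suc k"]] by simp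
qed

end

end

section \<open>Square-integrable functions\<close>

text \<open>A pointwise vector space structure on functions, so that \<open>L2\<close> can be the
  carrier of \<open>semi_inner\<close>.\<close>

instantiation "fun" :: (type, scaleR) scaleR
begin

definition scaleR_fun :: "real \<Rightarrow> ('a \<Rightarrow> 'b) \<Rightarrow> 'a \<Rightarrow> 'b" where "scaleR_fun a f = (\<lambda>x. a *\<^sub>R f x)"

instance ..

end

lemma scaleR_fun_apply [simp]: "(a *\<^sub>R f) x = a *\<^sub>R f x"
  by (simp add: scaleR_fun_def)

instance "fun" :: (type, real_vector) real_vector
  by standard (auto simp: fun_eq_iff scaleR_add_left scaleR_add_right)

lemma L2_integrable_mult:
  assumes "f \<in> L2 M" "g \<in> L2 M"
  shows "integrable M (\<lambda>z. f z * g z)"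
proof (rule Bochner_Integration.integrable_bound)
  have [measurable]: "f \<in> borel_measurable M" "g \<in> borel_measurable M"
    using assms by (auto simp: L2_def)
  show "integrable M (\<lambda>z. (f z)\<^sup>2 + (g z)\<^sup>2)" using assms by (auto simp: L2_def)
  show "(\<lambda>z. f z * g z) \<in> borel_measurable M" by measurable
  have "norm (a * b) \<le> norm (a\<^sup>2 + b\<^sup>2)" for a b :: real
    using sum_squares_bound[of "\<bar>a\<bar>" "\<bar>b\<bar>"] mult_nonneg_nonneg[of "\<bar>a\<bar>" "\<bar>b\<bar>"]
    by (simp add: abs_mult del: mult_nonneg_nonneg zero_le_mult_iff)
  then show "AE z in M. norm (f z * g z) \<le> norm ((f z)\<^sup>2 + (g z)\<^sup>2)" by simp
qed

lemma semi_inner_L2: "semi_inner (L2 M) (l2_inner M)"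
proof
  have "(\<lambda>z. (f z + g z)\<^sup>2) = (\<lambda>z. (f z)\<^sup>2 + (g z)\<^sup>2 + 2 * (f z * g z))" for f g :: "'a \<Rightarrow> real"
    by (simp add: power2_sum fun_eq_iff)
  then show "subspace (L2 M)"
    using L2_integrable_mult[of _ M]
    by (auto simp: subspace_def L2_def zero_fun_def plus_fun_def scaleR_fun_def power_mult_distrib)
next
  show "l2_inner M f g = l2_inner M g f" for f g by (simp add: l2_inner_def mult.commute)
qed (auto simp: l2_inner_def distrib_right mult.assoc L2_integrable_mult)

locale prob_L2 = prob_space M for M :: "'z measure"
begin

sublocale semi_inner "L2 M" "l2_inner M" by (rule semi_inner_L2)

lemma nrm_eq: "nrm f = l2_norm M f"
  by (simp add: nrm_def l2_norm_def)

lemma nrm_sq_integral: "f \<in> L2 M \<Longrightarrow> (nrm f)\<^sup>2 = (\<integral>z. (f z)\<^sup>2 \<partial>M)"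
  unfolding nrm_sq l2_inner_def by (simp add: power2_eq_square)

lemma const_L2: "(\<lambda>_. a) \<in> L2 M"
  by (simp add: L2_def)

lemma integral_abs_le_nrm:
  assumes "f \<in> L2 M"
  shows "integrable M f" "(\<integral>z. \<bar>f z\<bar> \<partial>M) \<le> nrm f"
proof -
  have af: "(\<lambda>z. \<bar>f z\<bar>) \<in> L2 M" using assms by (auto simp: L2_def)
  have "\<bar>l2_inner M (\<lambda>z. \<bar>f z\<bar>) (\<lambda>_. 1)\<bar> \<le> nrm (\<lambda>z. \<bar>f z\<bar>) * nrm (\<lambda>_. 1)"
    by (rule Cauchy_Schwarz[OF af const_L2])
  moreover have "nrm (\<lambda>_. 1) = 1" "nrm (\<lambda>z. \<bar>f z\<bar>) = nrm f"
    by (simp_all add: nrm_def l2_inner_def prob_space)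
  ultimately show "(\<integral>z. \<bar>f z\<bar> \<partial>M) \<le> nrm f" by (simp add: l2_inner_def)
  show "integrable M f" using L2_integrable_mult[OF assms const_L2[of 1]] by simp
qed

text \<open>Fatou's lemma for the squares of \<open>g - X k\<close>. With \<open>g\<close> a late
  member of a Cauchy sequence, it shows at once that the a.e. limit is square-integrable and how
  close it is.\<close>

lemma L2_Fatou:
  assumes X: "\<And>k. X k \<in> L2 M" and f [measurable]: "f \<in> borel_measurable M"
    and lim: "AE z in M. (\<lambda>k. X k z) \<longlonglongrightarrow> f z"
    and g: "g \<in> L2 M" and e: "e \<ge> 0" and le: "\<forall>\<^sub>F k in sequentially. nrm (g - X k) \<le> e"
  shows "f \<in> L2 M" "nrm (g - f) \<le> e"
proof -
  have [measurable]: "X k \<in> borel_measurable M" "g \<in> borel_measurable M" for k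
    using X g by (auto simp: L2_def)
  have "(\<integral>\<^sup>+z. ennreal ((g z - f z)\<^sup>2) \<partial>M) = (\<integral>\<^sup>+z. liminf (\<lambda>k. ennreal ((g z - X k z)\<^sup>2)) \<partial>M)"
  proof (rule nn_integral_cong_AE)
    show "AE z in M. ennreal ((g z - f z)\<^sup>2) = liminf (\<lambda>k. ennreal ((g z - X k z)\<^sup>2))"
      using lim
    proof eventually_elim
      fix z assume "(\<lambda>k. X k z) \<longlonglongrightarrow> f z"
      then have "(\<lambda>k. ennreal ((g z - X k z)\<^sup>2)) \<longlonglongrightarrow> ennreal ((g z - f z)\<^sup>2)"
        by (intro tendsto_intros) auto
      then show "ennreal ((g z - f z)\<^sup>2) = liminf (\<lambda>k. ennreal ((g z - X k z)\<^sup>2))"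
        by (intro lim_imp_Liminf[symmetric]) auto
    qed
  qed
  also have "\<dots> \<le> liminf (\<lambda>k. \<integral>\<^sup>+z. ennreal ((g z - X k z)\<^sup>2) \<partial>M)"
    by (rule nn_integral_liminf) measurable
  also have "\<dots> \<le> limsup (\<lambda>k. \<integral>\<^sup>+z. ennreal ((g z - X k z)\<^sup>2) \<partial>M)"
    by (rule Liminf_le_Limsup) simp
  also have "\<dots> \<le> ennreal (e\<^sup>2)"
  proof (rule Limsup_bounded)
    show "\<forall>\<^sub>F k in sequentially. (\<integral>\<^sup>+z. ennreal ((g z - X k z)\<^sup>2) \<partial>M) \<le> ennreal (e\<^sup>2)"
      using le
    proof eventually_elim
      fix k assume k: "nrm (g - X k) \<le> e"
      have gX: "g - X k \<in> L2 M" using g X by auto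
      then have "(\<integral>\<^sup>+z. ennreal ((g z - X k z)\<^sup>2) \<partial>M) = ennreal ((nrm (g - X k))\<^sup>2)"
        by (subst nn_integral_eq_integral) (auto simp: nrm_sq_integral, auto simp: L2_def)
      also have "\<dots> \<le> ennreal (e\<^sup>2)"
        using k gX by (intro ennreal_leI power_mono) auto
      finally show "(\<integral>\<^sup>+z. ennreal ((g z - X k z)\<^sup>2) \<partial>M) \<le> ennreal (e\<^sup>2)" .
    qed
  qed
  finally have bound: "(\<integral>\<^sup>+z. ennreal ((g z - f z)\<^sup>2) \<partial>M) \<le> ennreal (e\<^sup>2)" .
  have "integrable M (\<lambda>z. (g z - f z)\<^sup>2)"
    by (rule integrableI_bounded) (use bound in \<open>auto simp: le_less_trans\<close>)
  then have gf: "g - f \<in> L2 M" by (simp add: L2_def fun_diff_def)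
  have "g - (g - f) \<in> L2 M" using g gf by (rule H_closed)
  then show "f \<in> L2 M" by simp
  have "(\<integral>\<^sup>+z. ennreal ((g z - f z)\<^sup>2) \<partial>M) = ennreal ((nrm (g - f))\<^sup>2)"
    using gf by (subst nn_integral_eq_integral) (auto simp: nrm_sq_integral, auto simp: L2_def)
  then have "(nrm (g - f))\<^sup>2 \<le> e\<^sup>2" using bound by simp
  then show "nrm (g - f) \<le> e" using e by (rule power2_le_imp_le)
qed

text \<open>The Riesz-Fischer argument. The increments along fast indices have summable L^1 norms,
  which the L^2 norms dominate on a probability space; this gives a limit a.e., and
  \<open>L2_Fatou\<close> turns it into a limit in seminorm of the full sequence.\<close>

lemma L2_complete:
  assumes X: "\<And>n. X n \<in> L2 M"
    and cauchy: "\<And>e. e > 0 \<Longrightarrow> \<exists>N. \<forall>m\<ge>N. \<forall>n\<ge>N. nrm (X m - X n) < e"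
  shows "\<exists>f. conv X f sequentially"
proof -
  have X_meas [measurable]: "X n \<in> borel_measurable M" for n using X by (auto simp: L2_def)
  have dX: "X m - X n \<in> L2 M" for m n using X by auto
  have "\<exists>N. \<forall>m\<ge>N. \<forall>n\<ge>N. nrm (X m - X n) < (1/2)^k" for k
    by (rule cauchy) simp
  then obtain N where N: "\<And>k m n. \<lbrakk>N k \<le> m; N k \<le> n\<rbrakk> \<Longrightarrow> nrm (X m - X n) < (1/2)^k" by metis
  \<comment> \<open>The partial sum dominates each of its terms, so both \<open>r k\<close> and
    \<open>r (Suc k)\<close> lie past \<open>N k\<close>.\<close>
  define r where "r k = (\<Sum>i\<le>k. N i)" for k
  have rN: "N k \<le> r j" if "k \<le> j" for k j
    unfolding r_def using that by (intro member_le_sum) auto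
  define h where "h k z = X (r (Suc k)) z - X (r k) z" for k z
  have h_eq: "h k = X (r (Suc k)) - X (r k)" for k by (simp add: h_def fun_eq_iff)
  have hL2: "h k \<in> L2 M" for k unfolding h_eq by (rule dX)
  have h_int: "(\<integral>\<^sup>+z. ennreal \<bar>h k z\<bar> \<partial>M) \<le> ennreal ((1/2)^k)" for k
  proof -
    have "(\<integral>\<^sup>+z. ennreal \<bar>h k z\<bar> \<partial>M) = ennreal (\<integral>z. \<bar>h k z\<bar> \<partial>M)"
      using integral_abs_le_nrm(1)[OF hL2] by (intro nn_integral_eq_integral) auto
    also have "\<dots> \<le> ennreal ((1/2)^k)"
      using integral_abs_le_nrm(2)[OF hL2, of k] N[of k "r (Suc k)" "r k"] rN
      by (intro ennreal_leI) (auto simp: h_eq)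
    finally show ?thesis .
  qed
  have "(\<integral>\<^sup>+z. (\<Sum>k. ennreal \<bar>h k z\<bar>) \<partial>M) = (\<Sum>k. \<integral>\<^sup>+z. ennreal \<bar>h k z\<bar> \<partial>M)"
    unfolding h_def by (intro nn_integral_suminf) measurable
  also have "\<dots> \<le> (\<Sum>k. ennreal ((1/2)^k))"
    by (intro suminf_le h_int) auto
  also have "\<dots> < \<infinity>"
    by (subst suminf_ennreal2) (auto intro: summable_geometric)
  finally have "AE z in M. (\<Sum>k. ennreal \<bar>h k z\<bar>) \<noteq> \<infinity>"
    unfolding h_def by (intro nn_integral_noteq_infinite) auto
  then have ae: "AE z in M. (\<lambda>k. X (r k) z) \<longlonglongrightarrow> lim (\<lambda>k. X (r k) z)"
  proof eventually_elim
    fix z assume "(\<Sum>k. ennreal \<bar>h k z\<bar>) \<noteq> \<infinity>"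
    then have "summable (\<lambda>k. \<bar>h k z\<bar>)" by (intro summable_suminf_not_top) auto
    then have "summable (\<lambda>k. h k z)" by (rule summable_rabs_cancel)
    then have "convergent (\<lambda>k. X (r k) z - X (r 0) z)"
      by (simp add: summable_iff_convergent h_def sum_lessThan_telescope[of "\<lambda>k. X (r k) z"])
    then have "convergent (\<lambda>k. X (r k) z)" by (simp add: convergent_diff_const_right_iff)
    then show "(\<lambda>k. X (r k) z) \<longlonglongrightarrow> lim (\<lambda>k. X (r k) z)" by (simp add: convergent_LIMSEQ_iff)
  qed
  \<comment> \<open>Where the sequence diverges, \<open>lim\<close> is a default value; this happens
    only on a null set.\<close>
  define f where "f z = lim (\<lambda>k. X (r k) z)" for z
  have f_meas: "f \<in> borel_measurable M" unfolding f_def by measurable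
  have est: "f \<in> L2 M \<and> nrm (X n - f) \<le> (1/2)^k" if "N k \<le> n" for n k
  proof -
    have "\<forall>\<^sub>F j in sequentially. nrm (X n - X (r j)) \<le> (1/2)^k"
      using eventually_ge_at_top[of k]
      by eventually_elim (use N[of k n] that rN in \<open>auto intro!: less_imp_le\<close>)
    then show ?thesis
      using L2_Fatou[of "\<lambda>k. X (r k)" f "X n" "(1/2)^k"] X f_meas ae by (auto simp: f_def)
  qed
  have "(\<lambda>n. nrm (X n - f)) \<longlonglongrightarrow> 0"
  proof (rule LIMSEQ_I)
    fix e :: real assume "e > 0"
    then obtain k where k: "(1/2)^k < e" using real_arch_pow_inv[of e "1/2"] by auto
    have "norm (nrm (X n - f) - 0) < e" if "N k \<le> n" for n
      using est[OF that] k X[of n] nrm_ge_0[of "X n - f"] by auto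
    then show "\<exists>no. \<forall>n\<ge>no. norm (nrm (X n - f) - 0) < e" by blast
  qed
  then show ?thesis using est[of 0 "N 0"] X by (auto simp: conv_def)
qed

lemma L2_dominated:
  assumes X: "\<And>n. X n \<in> L2 M" and f: "f \<in> L2 M" and w: "w \<in> L2 M"
    and lim: "\<And>z. (\<lambda>n. X n z) \<longlonglongrightarrow> f z" and le: "\<And>n z. \<bar>X n z - f z\<bar> \<le> w z"
  shows "conv X f sequentially"
proof -
  have [measurable]: "X n \<in> borel_measurable M" "f \<in> borel_measurable M" for n
    using X f by (auto simp: L2_def)
  have "(\<lambda>n. \<integral>z. (X n z - f z)\<^sup>2 \<partial>M) \<longlonglongrightarrow> (\<integral>z. 0 \<partial>M)"
  proof (rule integral_dominated_convergence[where w = "\<lambda>z. (w z)\<^sup>2"])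
    show "integrable M (\<lambda>z. (w z)\<^sup>2)" using w by (simp add: L2_def)
    have "(\<lambda>n. (X n z - f z)\<^sup>2) \<longlonglongrightarrow> (f z - f z)\<^sup>2" for z by (intro tendsto_intros lim)
    then show "AE z in M. (\<lambda>n. (X n z - f z)\<^sup>2) \<longlonglongrightarrow> 0" by simp
    have "(X n z - f z)\<^sup>2 \<le> (w z)\<^sup>2" for n z
      using le[of n z] by (metis abs_ge_zero power2_abs power_mono)
    then show "AE z in M. norm ((X n z - f z)\<^sup>2) \<le> (w z)\<^sup>2" for n by simp
  qed measurable
  then have "(\<lambda>n. sqrt (\<integral>z. (X n z - f z)\<^sup>2 \<partial>M)) \<longlonglongrightarrow> sqrt 0"
    by (intro tendsto_real_sqrt) simp
  then show ?thesis
    using X f by (simp add: conv_def nrm_def l2_inner_def power2_eq_square)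
qed

end

section \<open>The extension of a Markov semigroup\<close>

lemma apply_bcontfun_simps:
  "apply_bcontfun (u + v) = apply_bcontfun u + apply_bcontfun v"
  "apply_bcontfun (u - v) = apply_bcontfun u - apply_bcontfun v"
  "apply_bcontfun (a *\<^sub>R u) = a *\<^sub>R apply_bcontfun u"
  for u v :: "'z::topological_space \<Rightarrow>\<^sub>C real"
  by (simp_all add: fun_eq_iff)

declare plus_bcontfun.rep_eq [simp del] minus_bcontfun.rep_eq [simp del] scaleR_bcontfun.rep_eq [simp del]

section \<open>Density of the continuous functions in L^2\<close>

locale borel_prob_L2 = prob_L2 M for M :: "'z::topological_space measure" +
  assumes sets_M: "sets M = sets borel"
    and metrizable: "metrizable_space (euclidean :: 'z topology)"
begin

lemma space_M: "space M = UNIV"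
  using sets_eq_imp_space_eq[OF sets_M] by simp

lemma bcontfun_measurable [measurable]: "apply_bcontfun u \<in> borel_measurable M"
  using borel_measurable_continuous_onI[OF continuous_on_apply_bcontfun]
  by (simp add: measurable_cong_sets[OF sets_M refl])

lemma bounded_L2:
  assumes [measurable]: "f \<in> borel_measurable M" and "\<And>z. \<bar>f z\<bar> \<le> b"
  shows "f \<in> L2 M" "nrm f \<le> b"
proof -
  have b: "0 \<le> b" using order_trans[OF abs_ge_zero assms(2)] .
  have le: "(f z)\<^sup>2 \<le> b\<^sup>2" for z using assms(2)[of z] by (metis abs_ge_zero power2_abs power_mono)
  have int: "integrable M (\<lambda>z. (f z)\<^sup>2)"
    by (rule integrable_const_bound[of _ "b\<^sup>2"]) (use le in auto)
  then show L2: "f \<in> L2 M" by (simp add: L2_def)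
  have "(\<integral>z. (f z)\<^sup>2 \<partial>M) \<le> (\<integral>z. b\<^sup>2 \<partial>M)" using le int by (intro integral_mono) auto
  then have "(nrm f)\<^sup>2 \<le> b\<^sup>2" using L2 by (simp add: nrm_sq_integral prob_space)
  then show "nrm f \<le> b" using b by (rule power2_le_imp_le)
qed

lemma bcontfun_L2 [simp, intro]: "apply_bcontfun u \<in> L2 M"
  and nrm_bcontfun_le: "nrm (apply_bcontfun u) \<le> norm u"
  using bounded_L2[of "apply_bcontfun u" "norm u"] norm_bounded[of u] by auto

definition bcontfun_closure :: "('z \<Rightarrow> real) set" where
  "bcontfun_closure = {f \<in> L2 M. \<forall>e>0. \<exists>u. nrm (f - apply_bcontfun u) < e}"

lemma bcontfun_closure_limit:
  assumes "\<And>n. X n \<in> bcontfun_closure" "conv X f sequentially"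
  shows "f \<in> bcontfun_closure"
  unfolding bcontfun_closure_def
proof (safe)
  show f: "f \<in> L2 M" using assms by (simp add: conv_def)
  fix e :: real assume e: "e > 0"
  have "\<forall>\<^sub>F n in sequentially. nrm (X n - f) < e / 2"
    using assms(2) e by (intro order_tendstoD(2)[of _ 0]) (auto simp: conv_def)
  then obtain n where n: "nrm (X n - f) < e / 2" by (auto simp: eventually_sequentially)
  have X: "X n \<in> L2 M" using assms(1) by (simp add: bcontfun_closure_def)
  obtain u where u: "nrm (X n - apply_bcontfun u) < e / 2"
    using assms(1)[of n] e by (auto simp: bcontfun_closure_def dest: spec[of _ "e / 2"])
  have "nrm (f - apply_bcontfun u) \<le> nrm (f - X n) + nrm (X n - apply_bcontfun u)"
    using f X by (intro nrm_triangle_diff) auto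
  then have "nrm (f - apply_bcontfun u) < e" using n u f X by (simp add: nrm_diff_commute)
  then show "\<exists>u. nrm (f - apply_bcontfun u) < e" by blast
qed

lemma bcontfun_closure_bcontfun: "apply_bcontfun u \<in> bcontfun_closure"
  unfolding bcontfun_closure_def by (auto intro!: exI[of _ u])

lemma bcontfun_closure_approx:
  assumes "f \<in> bcontfun_closure"
  shows "\<exists>u. conv (\<lambda>n. apply_bcontfun (u n)) f sequentially"
proof -
  have f: "f \<in> L2 M" using assms by (simp add: bcontfun_closure_def)
  have "\<exists>u. nrm (f - apply_bcontfun u) < 1 / real (Suc n)" for n
    using assms by (simp add: bcontfun_closure_def)
  then obtain u where u: "\<And>n. nrm (f - apply_bcontfun (u n)) < 1 / real (Suc n)" by metis
  have "conv (\<lambda>n. apply_bcontfun (u n)) f sequentially"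
  proof (rule convI[where r = "\<lambda>n. 1 / real (Suc n)"])
    show "\<forall>\<^sub>F n in sequentially. nrm (apply_bcontfun (u n) - f) \<le> 1 / real (Suc n)"
      using u f by (auto simp: nrm_diff_commute intro!: always_eventually less_imp_le)
    show "(\<lambda>n. 1 / real (Suc n)) \<longlonglongrightarrow> 0" by (rule LIMSEQ_Suc[OF lim_1_over_n])
  qed (use f in auto)
  then show ?thesis by blast
qed

lemma bcontfun_closure_add: assumes "f \<in> bcontfun_closure" "g \<in> bcontfun_closure" shows "f + g \<in> bcontfun_closure"
proof -
  obtain u v where "conv (\<lambda>n. apply_bcontfun (u n)) f sequentially"
    "conv (\<lambda>n. apply_bcontfun (v n)) g sequentially" using assms bcontfun_closure_approx by blast
  note conv_add[OF this]
  then show ?thesis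
    by (intro bcontfun_closure_limit[where X = "\<lambda>n. apply_bcontfun (u n + v n)", OF bcontfun_closure_bcontfun])
      (simp add: apply_bcontfun_simps)
qed

lemma bcontfun_closure_scale: assumes "f \<in> bcontfun_closure" shows "a *\<^sub>R f \<in> bcontfun_closure"
proof -
  obtain u where "conv (\<lambda>n. apply_bcontfun (u n)) f sequentially" using assms bcontfun_closure_approx by blast
  note conv_scale[OF this tendsto_const[of a]]
  then show ?thesis
    by (intro bcontfun_closure_limit[where X = "\<lambda>n. apply_bcontfun (a *\<^sub>R u n)", OF bcontfun_closure_bcontfun])
      (simp add: apply_bcontfun_simps)
qed

lemma bcontfun_closure_sum: "(\<And>i. i \<in> I \<Longrightarrow> f i \<in> bcontfun_closure) \<Longrightarrow> (\<lambda>z. \<Sum>i\<in>I. f i z) \<in> bcontfun_closure"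
proof (induction I rule: infinite_finite_induct)
  case (insert i I)
  then have "f i + (\<lambda>z. \<Sum>i\<in>I. f i z) \<in> bcontfun_closure" by (intro bcontfun_closure_add) auto
  then show ?case using insert by (simp add: plus_fun_def)
qed (use bcontfun_closure_scale[OF bcontfun_closure_bcontfun, of 0] in \<open>auto simp: zero_fun_def\<close>)

text \<open>The uniform bound makes the constant 2 a square-integrable majorant of the differences,
  so pointwise convergence implies convergence in L^2.\<close>

lemma bcontfun_closure_bounded_limit:
  assumes "\<And>n. X n \<in> bcontfun_closure" "f \<in> borel_measurable M" "\<And>z. (\<lambda>n. X n z) \<longlonglongrightarrow> f z"
    "\<And>n z. \<bar>X n z\<bar> \<le> 1"
  shows "f \<in> bcontfun_closure"
proof -
  have f1: "\<bar>f z\<bar> \<le> 1" for z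
    using tendsto_rabs[OF assms(3)[of z]] assms(4) by (intro LIMSEQ_le_const2[of "\<lambda>n. \<bar>X n z\<bar>"]) auto
  have "conv X f sequentially"
  proof (rule L2_dominated)
    show "\<bar>X n z - f z\<bar> \<le> 2" for n z using assms(4)[of n z] f1[of z] by linarith
  qed (use assms bounded_L2(1)[OF assms(2) f1] const_L2 in \<open>auto simp: bcontfun_closure_def\<close>)
  then show ?thesis using assms(1) by (rule bcontfun_closure_limit[rotated])
qed

text \<open>In a metrizable space \<open>F\<close> is the intersection of a decreasing sequence of
  open sets \<open>C n\<close>. Urysohn functions equal to 1 on \<open>F\<close> and 0 off
  \<open>C n\<close> converge pointwise to the indicator.\<close>

lemma bcontfun_closure_indicator_closed:
  assumes F: "closed F"
  shows "(indicator F :: 'z \<Rightarrow> real) \<in> bcontfun_closure"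
proof -
  have "gdelta_in euclidean F"
    using F by (intro closed_imp_gdelta_in metrizable) auto
  then obtain C where C: "\<And>n. open (C n)" "\<And>n. C (Suc n) \<subseteq> C n" "\<Inter>(range C) = F"
    unfolding gdelta_in_descending by auto
  have "\<exists>f. continuous_on UNIV f \<and> (\<forall>z. 0 \<le> f z \<and> f z \<le> (1::real)) \<and> (\<forall>z\<in>F. f z = 1) \<and> (\<forall>z. z \<notin> C n \<longrightarrow> f z = 0)" for n
  proof -
    have "disjnt (- C n) F" "closed (- C n)" using C by (auto simp: disjnt_def closed_Compl)
    then obtain f :: "'z \<Rightarrow> real" where f: "continuous_map euclidean (top_of_set {0..1}) f"
      "f ` (- C n) \<subseteq> {0}" "f ` F \<subseteq> {1}"
      using Urysohn_lemma[of euclidean "- C n" F 0 1] metrizable_imp_normal_space[OF metrizable] C F by auto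
    from f(1) have "continuous_on UNIV f" "\<And>z. 0 \<le> f z \<and> f z \<le> 1"
      by (auto simp: continuous_map_in_subtopology Pi_iff image_subset_iff)
    then show ?thesis using f(2,3) by (intro exI[of _ f]) force
  qed
  then obtain f where f: "\<And>n. continuous_on UNIV (f n)" "\<And>n z. 0 \<le> f n z \<and> f n z \<le> (1::real)"
    "\<And>n z. z \<in> F \<Longrightarrow> f n z = 1" "\<And>n z. z \<notin> C n \<Longrightarrow> f n z = 0"
    by metis
  have bc: "f n \<in> bcontfun" for n using f(1,2) by (intro bcontfun_normI[of _ 1]) auto
  have fV: "f n \<in> bcontfun_closure" for n
    using bcontfun_closure_bcontfun[of "Bcontfun (f n)"] by (simp add: Bcontfun_inverse[OF bc])
  have anti: "C m \<subseteq> C n" if "n \<le> m" for m n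
    using C(2) that by (rule lift_Suc_antimono_le)
  show ?thesis
  proof (rule bcontfun_closure_bounded_limit[of f])
    show "indicator F \<in> borel_measurable M"
      using F by (intro borel_measurable_indicator) (auto simp: sets_M)
    fix z
    show "(\<lambda>n. f n z) \<longlonglongrightarrow> indicator F z"
    proof (cases "z \<in> F")
      case False
      then obtain n where "z \<notin> C n" using C(3) by blast
      then have "\<forall>\<^sub>F m in sequentially. f m z = 0"
        using f(4) anti by (intro eventually_sequentiallyI[of n]) blast
      then show ?thesis using False by (simp add: tendsto_eventually)
    qed (simp add: f(3))
    show "\<bar>f n z\<bar> \<le> 1" for n using f(2)[of n z] by auto
  qed (rule fV)
qed

text \<open>Dynkin's theorem with the closed sets as intersection-stable generator: complements use
  the constant 1, disjoint unions use bounded limits of finite sums.\<close>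

lemma bcontfun_closure_indicator:
  assumes "B \<in> sets M"
  shows "(indicator B :: 'z \<Rightarrow> real) \<in> bcontfun_closure"
proof -
  have "Int_stable (Collect closed :: 'z set set)" by (auto simp: Int_stable_def)
  moreover have "Collect closed \<subseteq> Pow (UNIV :: 'z set)" by simp
  moreover have "B \<in> sigma_sets UNIV (Collect closed)" using assms by (simp add: sets_M borel_eq_closed)
  ultimately show ?thesis
  proof (induction rule: sigma_sets_induct_disjoint)
    case (basic B)
    then show ?case by (intro bcontfun_closure_indicator_closed) simp
  next
    case empty
    then show ?case using bcontfun_closure_scale[OF bcontfun_closure_bcontfun, of 0] by (simp add: zero_fun_def)
  next
    case (compl B)
    have "apply_bcontfun (const_bcontfun 1) + (-1) *\<^sub>R indicator B \<in> bcontfun_closure"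
      using compl by (intro bcontfun_closure_add bcontfun_closure_scale bcontfun_closure_bcontfun)
    moreover have "apply_bcontfun (const_bcontfun 1) + (-1) *\<^sub>R indicator B = (indicator (UNIV - B) :: 'z \<Rightarrow> real)"
      by (auto simp: fun_eq_iff indicator_def)
    ultimately show ?case by simp
  next
    case (union B)
    have Bsets: "B i \<in> sets M" for i using union by (auto simp: sets_M borel_eq_closed)
    show ?case
    proof (rule bcontfun_closure_bounded_limit[of "\<lambda>n z. \<Sum>i<n. indicator (B i) z"])
      have eq: "(\<Sum>i<n. indicator (B i) z) = (indicator (\<Union>i<n. B i) z :: real)" for n z
        using union(1) by (intro indicator_UN_disjoint[symmetric]) (auto simp: disjoint_family_on_def)
      show "\<bar>\<Sum>i<n. indicator (B i) z\<bar> \<le> (1::real)" for n z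
        unfolding eq by (simp add: indicator_def)
      show "(\<lambda>n. \<Sum>i<n. indicator (B i) z) \<longlonglongrightarrow> (indicator (\<Union>i. B i) z :: real)" for z
        unfolding eq by (rule LIMSEQ_indicator_UN)
      show "(indicator (\<Union>i. B i) :: 'z \<Rightarrow> real) \<in> borel_measurable M"
        using Bsets by (intro borel_measurable_indicator) auto
    qed (use union in \<open>auto intro: bcontfun_closure_sum\<close>)
  qed
qed

text \<open>Simple functions with absolute value at most \<open>2 * \<bar>f z\<bar>\<close> converge
  to \<open>f\<close> pointwise; their distance to \<open>f\<close> is dominated by
  \<open>3 * \<bar>f z\<bar>\<close>.\<close>

lemma bcontfun_dense:
  assumes f: "f \<in> L2 M"
  shows "f \<in> bcontfun_closure"
proof -
  have [measurable]: "f \<in> borel_measurable M" using f by (simp add: L2_def)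
  obtain s where s: "\<And>i. simple_function M (s i)" "\<And>z. (\<lambda>i. s i z) \<longlonglongrightarrow> f z"
      "\<And>i z. \<bar>s i z\<bar> \<le> 2 * \<bar>f z\<bar>"
    using borel_measurable_implies_sequence_metric[of f M 0] by (auto simp: space_M)
  have sV: "s i \<in> bcontfun_closure" for i
  proof -
    have fin: "finite (range (s i))" and sets: "\<And>y. y \<in> range (s i) \<Longrightarrow> s i -` {y} \<in> sets M"
      using s(1)[of i] by (auto simp: simple_function_def space_M)
    have "(\<lambda>z. \<Sum>y\<in>range (s i). (y *\<^sub>R indicator (s i -` {y})) z) \<in> bcontfun_closure"
      using sets by (intro bcontfun_closure_sum bcontfun_closure_scale bcontfun_closure_indicator) auto
    moreover have "(\<Sum>y\<in>range (s i). (y *\<^sub>R indicator (s i -` {y})) z) = s i z" for z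
    proof -
      have "(\<Sum>y\<in>range (s i). (y *\<^sub>R indicator (s i -` {y})) z) =
          (\<Sum>y\<in>range (s i). if s i z = y then y else 0)"
        by (intro sum.cong) (auto simp: indicator_def)
      then show ?thesis using fin by simp
    qed
    ultimately show ?thesis by simp
  qed
  have "conv s f sequentially"
  proof (rule L2_dominated)
    show "(\<lambda>z. 3 * \<bar>f z\<bar>) \<in> L2 M" using f by (simp add: L2_def power_mult_distrib)
    show "\<bar>s n z - f z\<bar> \<le> 3 * \<bar>f z\<bar>" for n z using s(3)[of n z] by linarith
  qed (use sV s f in \<open>auto simp: bcontfun_closure_def\<close>)
  with sV show ?thesis by (rule bcontfun_closure_limit)
qed

lemma bcontfun_approx:
  assumes "f \<in> L2 M"
  obtains u where "conv (\<lambda>n. apply_bcontfun (u n)) f sequentially"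
  using bcontfun_closure_approx[OF bcontfun_dense[OF assms]] by blast

end

section \<open>The extension as a contraction semigroup\<close>

locale markov_L2 = borel_prob_L2 M for M :: "'z::topological_space measure" +
  fixes T :: "real \<Rightarrow> (('z \<Rightarrow>\<^sub>C real) \<Rightarrow>\<^sub>L ('z \<Rightarrow>\<^sub>C real))"
  assumes markov: "markov_semigroup T" and stationary: "stationary_measure T M"
begin

abbreviation c :: "('z \<Rightarrow>\<^sub>C real) \<Rightarrow> 'z \<Rightarrow> real" where "c \<equiv> apply_bcontfun"

abbreviation "S \<equiv> l2_extension M T"

lemma T_nonneg: "\<lbrakk>t \<ge> 0; \<And>z. 0 \<le> c g z\<rbrakk> \<Longrightarrow> 0 \<le> c (T t g) z"
  and T_const: "t \<ge> 0 \<Longrightarrow> T t (const_bcontfun 1) = const_bcontfun 1"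
  and T_zero: "T 0 g = g"
  and T_plus: "\<lbrakk>s \<ge> 0; t \<ge> 0\<rbrakk> \<Longrightarrow> T (s + t) g = T s (T t g)"
  and T_cont: "continuous_on {0..} (\<lambda>t. T t g)"
  and T_integral: "t \<ge> 0 \<Longrightarrow> (\<integral>z. c (T t g) z \<partial>M) = (\<integral>z. c g z \<partial>M)"
  using markov stationary by (auto simp: markov_semigroup_def markov_operator_def stationary_measure_def)

text \<open>Positivity is applied to \<open>(g - a)\<^sup>2\<close> with \<open>a = T t g z\<close>.\<close>

lemma T_square_le:
  assumes t: "t \<ge> 0" and g2: "\<And>z. c g2 z = (c g z)\<^sup>2"
  shows "(c (T t g) z)\<^sup>2 \<le> c (T t g2) z"
proof -
  define a where "a = c (T t g) z"
  have "0 \<le> c (T t (g2 - (2 * a) *\<^sub>R g + a\<^sup>2 *\<^sub>R const_bcontfun 1)) z"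
  proof (rule T_nonneg[OF t])
    fix x
    have "c (g2 - (2 * a) *\<^sub>R g + a\<^sup>2 *\<^sub>R const_bcontfun 1) x = (c g x - a)\<^sup>2"
      by (simp add: apply_bcontfun_simps g2 power2_diff algebra_simps)
    then show "0 \<le> c (g2 - (2 * a) *\<^sub>R g + a\<^sup>2 *\<^sub>R const_bcontfun 1) x" by simp
  qed
  also have "\<dots> = c (T t g2) z - a\<^sup>2"
    by (simp add: apply_bcontfun_simps blinfun.diff_right blinfun.add_right blinfun.scaleR_right T_const[OF t]
        power2_eq_square flip: a_def)
  finally show ?thesis by (simp add: a_def)
qed

text \<open>Integrate \<open>(T g)\<^sup>2 \<le> T (g\<^sup>2)\<close>; stationarity removes
  \<open>T\<close> on the right.\<close>

lemma T_contraction: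
  assumes t: "t \<ge> 0"
  shows "nrm (c (T t g)) \<le> nrm (c g)"
proof (rule power2_le_imp_le)
  have "(\<lambda>z. (c g z)\<^sup>2) \<in> bcontfun"
  proof (rule bcontfun_normI)
    show "continuous_on UNIV (\<lambda>z. (c g z)\<^sup>2)" by (intro continuous_intros) simp
    show "norm ((c g z)\<^sup>2) \<le> (norm g)\<^sup>2" for z
      using power_mono[OF norm_bounded[of g z] norm_ge_zero, of 2] by simp
  qed
  then obtain g2 where g2: "c g2 = (\<lambda>z. (c g z)\<^sup>2)" using Bcontfun_inverse by blast
  have int: "integrable M (\<lambda>z. (c u z)\<^sup>2)" "integrable M (c u)" for u
    using bcontfun_L2[of u] integral_abs_le_nrm(1)[OF bcontfun_L2, of u] by (simp_all add: L2_def)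
  have "(nrm (c (T t g)))\<^sup>2 = (\<integral>z. (c (T t g) z)\<^sup>2 \<partial>M)" by (intro nrm_sq_integral bcontfun_L2)
  also have "\<dots> \<le> (\<integral>z. c (T t g2) z \<partial>M)"
    using T_square_le[OF t, of g2 g] g2 by (intro integral_mono int) auto
  also have "\<dots> = (nrm (c g))\<^sup>2" by (simp add: T_integral[OF t] g2 nrm_sq_integral[OF bcontfun_L2])
  finally show "(nrm (c (T t g)))\<^sup>2 \<le> (nrm (c g))\<^sup>2" .
qed simp

lemma T_lipschitz: "t \<ge> 0 \<Longrightarrow> nrm (c (T t g) - c (T t h)) \<le> nrm (c g - c h)"
  using T_contraction[of t "g - h"] by (simp add: blinfun.diff_right apply_bcontfun_simps)

text \<open>This justifies the choice by \<open>SOME\<close>: by contractivity, \<open>T t\<close>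
  maps an approximating sequence to a Cauchy sequence, whose limit is an admissible value.\<close>

lemma l2_extension_spec:
  assumes t: "t \<ge> 0" and f: "f \<in> L2 M"
  shows "S t f \<in> L2 M \<and> (\<exists>u. conv (\<lambda>k. c (u k)) f sequentially \<and> conv (\<lambda>k. c (T t (u k))) (S t f) sequentially)"
proof -
  obtain u where u: "conv (\<lambda>n. c (u n)) f sequentially" using f by (rule bcontfun_approx)
  have "\<exists>h. conv (\<lambda>n. c (T t (u n))) h sequentially"
  proof (rule L2_complete)
    fix e :: real assume e: "e > 0"
    have "\<forall>\<^sub>F n in sequentially. nrm (c (u n) - f) < e / 2"
      using u e by (intro order_tendstoD(2)[of _ 0]) (auto simp: conv_def)
    then obtain N where N: "\<And>n. n \<ge> N \<Longrightarrow> nrm (c (u n) - f) < e / 2" by (auto simp: eventually_sequentially)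
    have "nrm (c (T t (u m)) - c (T t (u n))) < e" if "m \<ge> N" "n \<ge> N" for m n
    proof -
      have "nrm (c (T t (u m)) - c (T t (u n))) \<le> nrm (c (u m) - c (u n))" using t by (rule T_lipschitz)
      also have "\<dots> \<le> nrm (c (u m) - f) + nrm (f - c (u n))" using f by (intro nrm_triangle_diff) auto
      also have "\<dots> < e" using N[OF that(1)] N[OF that(2)] f by (simp add: nrm_diff_commute)
      finally show ?thesis .
    qed
    then show "\<exists>N. \<forall>m\<ge>N. \<forall>n\<ge>N. nrm (c (T t (u m)) - c (T t (u n))) < e" by blast
  qed auto
  then obtain h where h: "conv (\<lambda>n. c (T t (u n))) h sequentially" by blast
  define P where "P h \<longleftrightarrow> h \<in> L2 M \<and> (\<exists>u. (\<lambda>k. l2_norm M (\<lambda>z. c (u k) z - f z)) \<longlonglongrightarrow> 0 \<and>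
      (\<lambda>k. l2_norm M (\<lambda>z. c (T t (u k)) z - h z)) \<longlonglongrightarrow> 0)" for h
  have P_iff: "P h \<longleftrightarrow> h \<in> L2 M \<and> (\<exists>u. conv (\<lambda>k. c (u k)) f sequentially \<and> conv (\<lambda>k. c (T t (u k))) h sequentially)" for h
    using f by (auto simp: P_def conv_def nrm_eq fun_diff_def)
  have "h \<in> L2 M" using h by (simp add: conv_def)
  then have "P h" using u h by (auto simp: P_iff)
  then have "P (SOME h. P h)" by (rule someI[of P])
  moreover have "S t f = (SOME h. P h)" by (simp only: l2_extension_def P_def)
  ultimately have "P (S t f)" by simp
  then show ?thesis by (simp add: P_iff)
qed

lemma S_L2: "\<lbrakk>t \<ge> 0; f \<in> L2 M\<rbrakk> \<Longrightarrow> S t f \<in> L2 M"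
  using l2_extension_spec by blast

text \<open>So far \<open>S t f\<close> is controlled along a single unspecified sequence.
  Comparison with an arbitrary continuous function removes this dependence, and
  \<open>conv_T\<close> follows for every approximating sequence.\<close>

lemma S_T_diff_le:
  assumes t: "t \<ge> 0" and f: "f \<in> L2 M"
  shows "nrm (S t f - c (T t v)) \<le> nrm (f - c v)"
proof -
  obtain u where u: "conv (\<lambda>k. c (u k)) f sequentially" "conv (\<lambda>k. c (T t (u k))) (S t f) sequentially"
    using l2_extension_spec[OF assms] by blast
  show ?thesis
  proof (rule LIMSEQ_le)
    show "(\<lambda>k. nrm (c (T t (u k)) - c (T t v))) \<longlonglongrightarrow> nrm (S t f - c (T t v))"
      using u by (intro conv_nrm conv_diff conv_const) auto
    show "(\<lambda>k. nrm (c (u k) - c v)) \<longlonglongrightarrow> nrm (f - c v)"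
      using u by (intro conv_nrm conv_diff conv_const) auto
  qed (use T_lipschitz[OF t] in blast)
qed

lemma conv_T:
  assumes t: "t \<ge> 0" and u: "conv (\<lambda>k. c (u k)) f sequentially"
  shows "conv (\<lambda>k. c (T t (u k))) (S t f) sequentially"
proof (rule convI)
  have f: "f \<in> L2 M" using u by (simp add: conv_def)
  then show S: "S t f \<in> L2 M" using t by (simp add: S_L2)
  show "\<forall>\<^sub>F k in sequentially. nrm (c (T t (u k)) - S t f) \<le> nrm (c (u k) - f)"
  proof (intro always_eventually allI)
    fix k show "nrm (c (T t (u k)) - S t f) \<le> nrm (c (u k) - f)"
      using S_T_diff_le[OF t f, of "u k"] nrm_diff_commute[OF S, of "c (T t (u k))"]
        nrm_diff_commute[OF f, of "c (u k)"] by simp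
  qed
qed (use u in \<open>auto simp: conv_def\<close>)

text \<open>Each algebraic law holds exactly for \<open>T\<close>. Along approximating continuous
  functions its two sides are limits of the same sequence, hence equivalent.\<close>

sublocale contraction_semigroup "L2 M" "l2_inner M" S
proof
  fix t :: real and x y :: "'z \<Rightarrow> real" and a :: real
  assume t: "t \<ge> 0" and x: "x \<in> L2 M"
  show "S t x \<in> L2 M" using t x by (rule S_L2)
  obtain u where u: "conv (\<lambda>n. c (u n)) x sequentially" using x by (rule bcontfun_approx)
  show "eqv (S t (a *\<^sub>R x)) (a *\<^sub>R S t x)"
  proof (rule conv_unique[OF sequentially_bot])
    show "conv (\<lambda>n. c (T t (a *\<^sub>R u n))) (S t (a *\<^sub>R x)) sequentially"
      using conv_scale[OF u tendsto_const[of a]] t by (intro conv_T) (auto simp: apply_bcontfun_simps)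
    show "conv (\<lambda>n. c (T t (a *\<^sub>R u n))) (a *\<^sub>R S t x) sequentially"
      using conv_scale[OF conv_T[OF t u] tendsto_const[of a]]
      by (simp add: apply_bcontfun_simps blinfun.scaleR_right)
  qed
  show "nrm (S t x) \<le> nrm x"
    by (rule LIMSEQ_le[OF conv_nrm[OF conv_T[OF t u]] conv_nrm[OF u]]) (use T_contraction[OF t] in blast)
  show "eqv (S (s + t) x) (S s (S t x))" if s: "s \<ge> 0" for s
    using conv_T[OF _ u, of "s + t"] conv_T[OF s conv_T[OF t u]] s t
    by (intro conv_unique[OF sequentially_bot]) (auto simp: T_plus)
  show "eqv (S t (x + y)) (S t x + S t y)" if y: "y \<in> L2 M"
  proof -
    obtain v where v: "conv (\<lambda>n. c (v n)) y sequentially" using y by (rule bcontfun_approx)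
    show ?thesis
    proof (rule conv_unique[OF sequentially_bot])
      show "conv (\<lambda>n. c (T t (u n + v n))) (S t (x + y)) sequentially"
        using conv_add[OF u v] t by (intro conv_T) (auto simp: apply_bcontfun_simps)
      show "conv (\<lambda>n. c (T t (u n + v n))) (S t x + S t y) sequentially"
        using conv_add[OF conv_T[OF t u] conv_T[OF t v]]
        by (simp add: apply_bcontfun_simps blinfun.add_right)
    qed
  qed
next
  fix x :: "'z \<Rightarrow> real" assume x: "x \<in> L2 M"
  obtain u where u: "conv (\<lambda>n. c (u n)) x sequentially" using x by (rule bcontfun_approx)
  show "eqv (S 0 x) x"
    using conv_T[OF _ u, of 0] u by (intro conv_unique[OF sequentially_bot]) (auto simp: T_zero)
  have "((\<lambda>t. nrm (S t x - x)) \<longlongrightarrow> 0) (at_right 0)"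
  proof (rule tendstoI)
    fix e :: real assume e: "e > 0"
    have "\<forall>\<^sub>F n in sequentially. nrm (c (u n) - x) < e / 3"
      using u e by (intro order_tendstoD(2)[of _ 0]) (auto simp: conv_def)
    then obtain n where n: "nrm (c (u n) - x) < e / 3" by (auto simp: eventually_sequentially)
    \<comment> \<open>Strong continuity is known in the supremum norm, which dominates the L^2
      seminorm; the two remaining errors are at most \<open>nrm (c (u n) - x)\<close>, uniformly in
      \<open>t\<close>.\<close>
    have "((\<lambda>t. T t (u n)) \<longlongrightarrow> T 0 (u n)) (at 0 within {0..})"
      using T_cont[of "u n"] by (auto simp: continuous_on_def)
    then have "((\<lambda>t. T t (u n)) \<longlongrightarrow> u n) (at_right 0)"
      unfolding T_zero by (rule tendsto_within_subset) auto
    then have "\<forall>\<^sub>F t in at_right 0. dist (T t (u n)) (u n) < e / 3" using e by (intro tendstoD) auto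
    moreover have "\<forall>\<^sub>F t in at_right 0. (0::real) < t" by (simp add: eventually_at_right_less)
    ultimately show "\<forall>\<^sub>F t in at_right 0. dist (nrm (S t x - x)) 0 < e"
    proof eventually_elim
      fix t :: real assume d: "dist (T t (u n)) (u n) < e / 3" and t: "0 < t"
      have Sx: "S t x \<in> L2 M" using t x by (simp add: S_L2)
      have "nrm (S t x - x) \<le> nrm (S t x - c (T t (u n))) + nrm (c (T t (u n)) - x)"
        using Sx x by (intro nrm_triangle_diff) auto
      moreover have "nrm (c (T t (u n)) - x) \<le> nrm (c (T t (u n)) - c (u n)) + nrm (c (u n) - x)"
        using x by (intro nrm_triangle_diff) auto
      moreover have "nrm (S t x - c (T t (u n))) \<le> nrm (c (u n) - x)"
        using S_T_diff_le[of t x "u n"] t x nrm_diff_commute[OF x, of "c (u n)"] by simp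
      moreover have "nrm (c (T t (u n)) - c (u n)) \<le> dist (T t (u n)) (u n)"
        using nrm_bcontfun_le[of "T t (u n) - u n"] by (simp add: dist_norm apply_bcontfun_simps)
      ultimately have "nrm (S t x - x) < e" using d n by linarith
      then show "dist (nrm (S t x - x)) 0 < e" using Sx x by simp
    qed
  qed
  moreover have "\<forall>\<^sub>F t in at_right 0. S t x \<in> L2 M"
    using eventually_at_right_less[of "0::real"] by eventually_elim (use x S_L2 in auto)
  ultimately show "conv (\<lambda>t. S t x) x (at_right 0)" using x by (simp add: conv_def)
qed

lemma l2_inner_one: "l2_inner M (\<lambda>_. 1) (\<lambda>_. 1) = 1"
  by (simp add: l2_inner_def prob_space)

lemma S_const_one: assumes "t \<ge> 0" shows "eqv (S t (\<lambda>_. 1)) (\<lambda>_. 1)"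
proof -
  have c1: "c (const_bcontfun 1) = (\<lambda>_. 1)" by (simp add: fun_eq_iff)
  have "nrm (S t (\<lambda>_. 1) - (\<lambda>_. 1)) \<le> 0"
    using S_T_diff_le[OF assms const_L2[of 1], of "const_bcontfun 1"] T_const[OF assms] by (simp add: c1)
  moreover have "0 \<le> nrm (S t (\<lambda>_. 1) - (\<lambda>_. 1))" using S_L2[OF assms const_L2] const_L2 by auto
  ultimately show ?thesis unfolding eqv_def by linarith
qed

lemma S_inner_one:
  assumes t: "t \<ge> 0" and f: "f \<in> L2 M"
  shows "l2_inner M (S t f) (\<lambda>_. 1) = l2_inner M f (\<lambda>_. 1)"
proof -
  obtain u where u: "conv (\<lambda>n. c (u n)) f sequentially" using f by (rule bcontfun_approx)
  have "(\<lambda>n. l2_inner M (c (T t (u n))) (\<lambda>_. 1)) \<longlonglongrightarrow> l2_inner M (S t f) (\<lambda>_. 1)"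
    using conv_T[OF t u] by (intro conv_ip conv_const const_L2)
  moreover have "l2_inner M (c (T t (u n))) (\<lambda>_. 1) = l2_inner M (c (u n)) (\<lambda>_. 1)" for n
    by (simp add: l2_inner_def T_integral[OF t])
  moreover have "(\<lambda>n. l2_inner M (c (u n)) (\<lambda>_. 1)) \<longlonglongrightarrow> l2_inner M f (\<lambda>_. 1)"
    using u by (intro conv_ip conv_const const_L2)
  ultimately show ?thesis using LIMSEQ_unique by simp
qed

lemma gen_iff: "gen f h \<longleftrightarrow> is_generator_value M S f h"
proof -
  have "(1 / t) *\<^sub>R (S t f - f) - h = (\<lambda>z. (S t f z - f z) / t - h z)" for t
    by (simp add: fun_eq_iff)
  moreover have "\<forall>\<^sub>F t in at_right 0. (1 / t) *\<^sub>R (S t f - f) \<in> L2 M" if "f \<in> L2 M"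
    using eventually_gt_0 by eventually_elim (use that in auto)
  ultimately show ?thesis
    by (auto simp: gen_def conv_def is_generator_value_def nrm_eq)
qed

lemma gen_generator: "f \<in> generator_dom M S \<Longrightarrow> gen f (generator M S f)"
  unfolding gen_iff generator_dom_def generator_def
  by (auto intro: someI[of "is_generator_value M S f"])

lemma normal_semigroupI:
  assumes "normal_operator M (generator_dom M S) (generator M S)"
  shows "normal_semigroup (L2 M) (l2_inner M) S (generator_dom M S) (generator M S)
    (adjoint_op M (generator_dom M S) (generator M S)) (\<lambda>_. 1)"
proof
  let ?D = "generator_dom M S" and ?A = "generator M S"
  let ?A' = "adjoint_op M ?D ?A"
  have D: "f \<in> ?D \<longleftrightarrow> (\<exists>h. is_adjoint_value M ?D ?A f h)" for f
    using assms by (auto simp: normal_operator_def adjoint_dom_def)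
  have adj: "is_adjoint_value M ?D ?A f (?A' f)" if "f \<in> ?D" for f
    using that unfolding D adjoint_op_def
    by (auto intro: someI[of "is_adjoint_value M ?D ?A f"])
  show "f \<in> ?D \<longleftrightarrow> (\<exists>h. gen f h)" for f by (simp add: gen_iff generator_dom_def)
  show "f \<in> ?D \<Longrightarrow> gen f (?A f)" for f by (rule gen_generator)
  show "f \<in> ?D \<longleftrightarrow> f \<in> L2 M \<and> (\<exists>h\<in>L2 M. \<forall>u\<in>?D. l2_inner M (?A u) f = l2_inner M u h)" for f
    unfolding D[of f] is_adjoint_value_def by blast
  show "?A' f \<in> L2 M" if "f \<in> ?D" for f
    using adj[OF that] by (simp add: is_adjoint_value_def)
  show "l2_inner M (?A u) f = l2_inner M u (?A' f)" if "f \<in> ?D" "u \<in> ?D" for f u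
    using adj[OF that(1)] that(2) by (simp add: is_adjoint_value_def)
  show "nrm (?A f) = nrm (?A' f)" if "f \<in> ?D" for f
    using assms that by (simp add: normal_operator_def nrm_eq)
  show "(\<lambda>_. 1) \<in> L2 M" by (rule const_L2)
qed (auto simp: L2_complete l2_inner_one S_const_one S_inner_one)

end

section \<open>Decay of log-convex families\<close>

lemma DERIV_powr_within:
  fixes f :: "real \<Rightarrow> real"
  assumes "(f has_real_derivative f') (at x within S)" "0 < f x"
  shows "((\<lambda>x. f x powr a) has_real_derivative a * f x powr (a - 1) * f') (at x within S)"
  by (rule DERIV_chain2[OF has_real_derivative_powr[OF assms(2)] assms(1)])

text \<open>In logarithmic form, a convex sequence has at index n at most the value of the chord
  from 0 to n + 1. The statement with integer powers also covers zeros of the sequence.\<close>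

lemma log_convex_interpolation:
  fixes a :: "nat \<Rightarrow> real"
  assumes nonneg: "\<And>m. 0 \<le> a m" and convex: "\<And>m. (a (Suc m))\<^sup>2 \<le> a m * a (Suc (Suc m))"
  shows "a n ^ Suc n \<le> a (Suc n) ^ n * a 0"
proof (induction n)
  case (Suc n)
  show ?case
  proof (cases "a (Suc n) = 0")
    case True
    then show ?thesis using nonneg by simp
  next
    case False
    then have "0 < a (Suc n)" using nonneg[of "Suc n"] by linarith
    then have pos: "0 < a (Suc n) ^ n" by (rule zero_less_power)
    \<comment> \<open>The claim is multiplied by \<open>a (Suc n) ^ n\<close>: the left side becomes
      a power of the square in the convexity hypothesis, and the factor reappears from the induction
      hypothesis and cancels.\<close>
    have "a (Suc n) ^ Suc (Suc n) * a (Suc n) ^ n = ((a (Suc n))\<^sup>2) ^ Suc n"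
      unfolding power_add[symmetric] power_mult[symmetric] by (rule arg_cong[where f = "power _"]) simp
    also have "\<dots> \<le> (a n * a (Suc (Suc n))) ^ Suc n"
      using convex by (intro power_mono) auto
    also have "\<dots> = a n ^ Suc n * a (Suc (Suc n)) ^ Suc n" by (rule power_mult_distrib)
    also have "\<dots> \<le> (a (Suc n) ^ n * a 0) * a (Suc (Suc n)) ^ Suc n"
      using Suc nonneg by (intro mult_right_mono) auto
    also have "\<dots> = (a (Suc (Suc n)) ^ Suc n * a 0) * a (Suc n) ^ n" by (simp only: mult_ac)
    finally show ?thesis using pos by (rule mult_right_le_imp_le)
  qed
qed simp

lemma log_convex_decay:
  fixes e :: "nat \<Rightarrow> real \<Rightarrow> real"
  assumes der: "\<And>m t. 0 \<le> t \<Longrightarrow> (e m has_real_derivative - e (Suc m) t) (at t within {0..})"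
    and nonneg: "\<And>m t. 0 \<le> t \<Longrightarrow> 0 \<le> e m t"
    and convex: "\<And>m t. 0 \<le> t \<Longrightarrow> (e (Suc m) t)\<^sup>2 \<le> e m t * e (Suc (Suc m)) t"
    and e0: "e 0 0 > 0" and n: "n \<ge> 1" and en: "e n 0 > 0" and t: "0 \<le> t"
  shows "e n t \<le> (e n 0 powr (- 1 / real n) + t / real n * e 0 0 powr (- 1 / real n)) powr (- real n)"
\<comment> \<open>A zero at \<open>t\<close> makes the claim trivial. Otherwise monotonicity keeps
  \<open>e n\<close> positive on all of \<open>[0, t]\<close>, so negative powers of it can be
  differentiated.\<close>
proof (cases "e n t = 0")
  case False
  define k where "k = real n"
  have k: "k \<ge> 1" using n by (simp add: k_def)
  define C where "C = e 0 0 powr (- 1 / k)"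
  have anti: "e m s' \<le> e m s" if "0 \<le> s" "s \<le> s'" for m s s'
    by (rule antimono_of_deriv_within[where S = "{0..}" and q = "e m" and a = s and b = s'
          and q' = "\<lambda>s. - e (Suc m) s"]) (use that der nonneg in auto)
  have pos: "0 < e n s" if "0 \<le> s" "s \<le> t" for s
    using anti[OF that, of n] False nonneg[OF t, of n] by linarith
  have key: "C \<le> e n s powr (- 1 / k - 1) * e (Suc n) s" if s: "0 \<le> s" "s \<le> t" for s
  proof -
    define a b where "a = e n s" and "b = e (Suc n) s"
    have a: "0 < a" and b0: "0 \<le> b" using pos[OF s] nonneg s by (auto simp: a_def b_def)
    have "a ^ Suc n \<le> b ^ n * e 0 s"
      using log_convex_interpolation[of "\<lambda>m. e m s" n] nonneg convex s by (simp add: a_def b_def)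
    also have "\<dots> \<le> b ^ n * e 0 0" using anti[of 0 s 0] s b0 by (intro mult_left_mono) auto
    finally have ab: "a ^ Suc n \<le> b ^ n * e 0 0" .
    have "0 < a ^ Suc n" using a by simp
    \<comment> \<open>Here \<open>n \<ge> 1\<close> matters: only then does \<open>b = 0\<close>
      make the right side of \<open>ab\<close> vanish.\<close>
    then have "b \<noteq> 0" using ab n by (cases n) auto
    with b0 have b: "0 < b" by simp
    have "a powr ((k + 1) / k) = (a ^ Suc n) powr (1 / k)"
      unfolding powr_realpow[OF a, symmetric] powr_powr by (simp add: k_def add.commute)
    also have "\<dots> \<le> (b ^ n * e 0 0) powr (1 / k)"
      using ab a k by (intro powr_mono2) auto
    also have "\<dots> = (b ^ n) powr (1 / k) * e 0 0 powr (1 / k)"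
      using b e0 by (simp add: powr_mult)
    also have "(b ^ n) powr (1 / k) = b"
      unfolding powr_realpow[OF b, symmetric] powr_powr using b n by (simp add: k_def)
    finally have "a powr ((k + 1) / k) * C \<le> b * e 0 0 powr (1 / k) * C"
      by (intro mult_right_mono) (auto simp: C_def)
    also have "\<dots> = b" using e0 by (simp add: C_def flip: powr_add)
    finally have "a powr (- 1 / k - 1) * (a powr ((k + 1) / k) * C) \<le> a powr (- 1 / k - 1) * b"
      by (intro mult_left_mono) auto
    moreover have "a powr (- 1 / k - 1) * a powr ((k + 1) / k) = 1"
      using a k by (simp add: field_simps flip: powr_add)
    ultimately show ?thesis by (simp add: a_def b_def flip: mult.assoc)
  qed
  \<comment> \<open>The derivative of \<open>q\<close> is
    \<open>C - e n s powr (- 1 / k - 1) * e (Suc n) s\<close> divided by \<open>k\<close>, so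
    \<open>key\<close> is exactly the statement that \<open>q\<close> does not increase.\<close>
  define q where "q s = s / k * C - e n s powr (- 1 / k)" for s
  have "q t \<le> q 0"
  proof (rule antimono_of_deriv_within[where S = "{0..}" and q = q and a = 0 and b = t
        and q' = "\<lambda>s. 1 / k * C - (- 1 / k) * e n s powr (- 1 / k - 1) * - e (Suc n) s"])
    fix s assume s: "0 \<le> s" "s \<le> t"
    have "((\<lambda>s. s / k * C) has_real_derivative 1 / k * C) (at s within {0..})"
      using k by (auto intro!: derivative_eq_intros)
    from DERIV_diff[OF this DERIV_powr_within[OF der[OF s(1)] pos[OF s]]]
    show "(q has_real_derivative 1 / k * C - (- 1 / k) * e n s powr (- 1 / k - 1) * - e (Suc n) s)
        (at s within {0..})" unfolding q_def .
    have "1 / k * C \<le> 1 / k * (e n s powr (- 1 / k - 1) * e (Suc n) s)"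
      using key[OF s] k by (intro mult_left_mono) auto
    then show "1 / k * C - (- 1 / k) * e n s powr (- 1 / k - 1) * - e (Suc n) s \<le> 0" by simp
  qed (use t in auto)
  then have le: "e n 0 powr (- 1 / k) + t / k * C \<le> e n t powr (- 1 / k)" by (simp add: q_def)
  have "0 < e n 0 powr (- 1 / k) + t / k * C"
    using en t k by (intro add_pos_nonneg) (auto simp: C_def)
  then have "(e n t powr (- 1 / k)) powr (- k) \<le> (e n 0 powr (- 1 / k) + t / k * C) powr (- k)"
    using le k by (intro powr_mono2') auto
  moreover have "(e n t powr (- 1 / k)) powr (- k) = e n t"
    using pos[OF t order_refl] k by (simp add: powr_powr)
  ultimately show ?thesis by (simp add: C_def k_def)
qed simp

text \<open>Dropping \<open>a\<close> from the base enlarges the bound, because the exponent is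
  negative; this leaves \<open>t powr (- k)\<close> with the explicit constant
  \<open>(c / k) powr (- k)\<close>.\<close>

lemma powr_decay_asymptotics:
  fixes f :: "real \<Rightarrow> real"
  assumes k: "k \<ge> 1" and a: "a \<ge> 0" and c: "c > 0" and nonneg: "\<And>t. 0 \<le> t \<Longrightarrow> 0 \<le> f t"
    and le: "\<And>t. 0 \<le> t \<Longrightarrow> f t \<le> (a + t / k * c) powr (- k)"
  shows "(f \<longlongrightarrow> 0) at_top" "f \<in> O[at_top](\<lambda>t. t powr (- k))"
proof -
  have bound: "f t \<le> (c / k) powr (- k) * t powr (- k)" if t: "0 < t" for t
  proof -
    have "f t \<le> (a + t / k * c) powr (- k)" using le t by simp
    also have "\<dots> \<le> (c / k * t) powr (- k)"
      using a c k t by (intro powr_mono2') (auto simp: mult.commute)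
    also have "\<dots> = (c / k) powr (- k) * t powr (- k)" by (rule powr_mult)
    finally show ?thesis .
  qed
  have pos: "\<forall>\<^sub>F t in at_top. (0::real) < t" by (rule eventually_gt_at_top)
  show "f \<in> O[at_top](\<lambda>t. t powr (- k))"
  proof (rule bigoI)
    show "\<forall>\<^sub>F t in at_top. norm (f t) \<le> (c / k) powr (- k) * norm (t powr (- k))"
      using pos by eventually_elim (use bound nonneg in auto)
  qed
  have "((\<lambda>t. (c / k) powr (- k) * t powr (- k)) \<longlongrightarrow> (c / k) powr (- k) * 0) at_top"
    using k by (intro tendsto_mult tendsto_const tendsto_neg_powr filterlim_ident) auto
  then have lim: "((\<lambda>t. (c / k) powr (- k) * t powr (- k)) \<longlongrightarrow> 0) at_top" by simp
  show "(f \<longlongrightarrow> 0) at_top"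
    by (rule tendsto_sandwich[OF _ _ tendsto_const lim]; use pos in eventually_elim)
      (use bound nonneg in auto)
qed

theorem theorem3p4:
  fixes T :: "real \<Rightarrow> (('z::topological_space \<Rightarrow>\<^sub>C real) \<Rightarrow>\<^sub>L ('z \<Rightarrow>\<^sub>C real))"
    and \<mu> :: "'z measure"
    and D :: "('z \<Rightarrow> real) set"
    and A :: "('z \<Rightarrow> real) \<Rightarrow> ('z \<Rightarrow> real)"
    and g0 :: "'z \<Rightarrow> real"
    and g :: "real \<Rightarrow> 'z \<Rightarrow> real"
    and e :: "nat \<Rightarrow> real \<Rightarrow> real"
    and n :: nat
  defines "D \<equiv> generator_dom \<mu> (l2_extension \<mu> T)"
    and "A \<equiv> generator \<mu> (l2_extension \<mu> T)"
    and "e \<equiv> \<lambda>m t. energy \<mu> A m (g t) (g t)"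
  assumes "compact (UNIV :: 'z set)"
    and "metrizable_space (euclidean :: 'z topology)"
    and "markov_semigroup T"
    and "stationary_measure T \<mu>"
    and "normal_operator \<mu> D A"
    and "g0 \<in> smooth_dom \<mu> D A"
    and "solves_cauchy_problem \<mu> D A g0 g"
    and "e 0 0 > 0"
    and "n \<ge> 1"
    and "e n 0 > 0"
  shows "(\<forall>t\<ge>0. e n t \<le>
            (e n 0 powr (- 1 / real n) + t / real n * e 0 0 powr (- 1 / real n)) powr (- real n))
         \<and> (e n \<longlongrightarrow> 0) at_top
         \<and> e n \<in> O[at_top](\<lambda>t. t powr (- real n))"
proof -
  interpret prob_space \<mu> using assms by (simp add: stationary_measure_def)
  interpret markov_L2 \<mu> T
    using assms by unfold_locales (auto simp: stationary_measure_def)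
  interpret normal_semigroup "L2 \<mu>" "l2_inner \<mu>" "l2_extension \<mu> T" D A "adjoint_op \<mu> D A" "\<lambda>_. 1"
    using assms normal_semigroupI by (simp add: D_def A_def)
  have E_eq: "E m = energy \<mu> A m" for m
    by (induction m) simp_all
  \<comment> \<open>The index shifts by one: level 0 of \<open>power_dom\<close> is all of
    \<open>L2\<close>, so only level \<open>Suc k\<close> puts the k-th iterate into
    \<open>D\<close>.\<close>
  have "(A ^^ k) f \<in> D" if "f \<in> power_dom \<mu> D A (Suc k)" for f k
    using that by (induction k arbitrary: f) (simp_all add: funpow_swap1)
  moreover have "g0 \<in> power_dom \<mu> D A (Suc k)" for k
    using \<open>g0 \<in> smooth_dom \<mu> D A\<close> by (simp add: smooth_dom_def del: power_dom.simps)
  ultimately have g0: "g0 \<in> Dinf" unfolding Dinf_def by blast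
  have g_D: "g t \<in> D" if "0 \<le> t" for t
    using assms that by (simp add: solves_cauchy_problem_def)
  have sol: "g t \<in> D \<and> has_der g (A (g t)) t" if t: "0 \<le> t" for t
  proof -
    have "(1 / (s - t)) *\<^sub>R (g s - g t) - A (g t) = (\<lambda>z. (g s z - g t z) / (s - t) - A (g t) z)" for s
      by (simp add: fun_eq_iff)
    moreover have "\<forall>\<^sub>F s in at t within {0..}. (1 / (s - t)) *\<^sub>R (g s - g t) \<in> L2 \<mu>"
      using eventually_within_ge by eventually_elim (use g_D[THEN D_H] t in auto)
    ultimately show ?thesis
      using assms t g_D D_H A_H by (auto simp: has_der_def conv_def solves_cauchy_problem_def nrm_eq)
  qed
  \<comment> \<open>The initial condition is given a.e.; vanishing of the integrated square
    translates it into equivalence.\<close>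
  have "eqv (g 0) g0"
  proof -
    have "AE z in \<mu>. g 0 z = g0 z" using assms by (simp add: solves_cauchy_problem_def)
    then have "(\<integral>z. (g 0 z - g0 z) * (g 0 z - g0 z) \<partial>\<mu>) = (\<integral>z. 0 \<partial>\<mu>)"
      using g_D[of 0, THEN D_H] Dinf_H[OF g0] by (intro integral_cong_AE) (auto simp: L2_def)
    then show ?thesis by (simp add: eqv_def nrm_def l2_inner_def)
  qed
  note sol = sol this g0
  have Dinf: "g t \<in> Dinf" if "0 \<le> t" for t
    using solution_iterates(1)[OF sol that, of 0] by simp
  have nonneg: "0 \<le> e m t" if "0 \<le> t" for m t
    using E_nonneg[OF Dinf[OF that]] by (simp add: e_def E_eq)
  have bound: "e n t \<le> (e n 0 powr (- 1 / real n) + t / real n * e 0 0 powr (- 1 / real n)) powr (- real n)"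
    if t: "0 \<le> t" for t
  proof (rule log_convex_decay)
    show "(e m has_real_derivative - e (Suc m) t) (at t within {0..})" if "0 \<le> t" for m t
      using E_has_derivative[OF sol that, of m 0 0] by (simp add: e_def E_eq del: energy.simps E.simps)
    show "(e (Suc m) t)\<^sup>2 \<le> e m t * e (Suc (Suc m)) t" if "0 \<le> t" for m t
      using E_log_convex[OF Dinf[OF that], of m] by (simp add: e_def E_eq del: energy.simps E.simps)
  qed (use assms nonneg t in auto)
  show ?thesis
    using bound powr_decay_asymptotics[OF _ _ _ nonneg bound] assms by auto
qed

end
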